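(* Let $G$ be a graph with clique number $\omega$, let $t$ be an integer with $2\le t\le \omega$, and let $\rho_t(G)$ be the $t$-clique spectral radius of $G$. Then $$\left( \frac{\rho_{t}(G)}{t} \right)^{t}\le \left( \sum_{I\in C_t(G)}\sqrt[t-1]{\binom{\alpha(I)}{t}\left(\alpha(I)\right)^{-t}} \right)^{t-1}.$$ Equality holds if and only if the graph obtained from $G$ by deleting all edges not contained in $t$-cliques of $G$ is, possibly together with some isolated vertices, a complete $\omega$-partite graph in the case $\omega=t$, or a complete regular $\omega$-partite graph in the case $\omega\ge t+1$.
   Context: All graphs are finite, simple and undirected. A clique of $G$ is a set of vertices whose induced subgraph is complete; a $t$-clique is a clique with exactly $t$ vertices; $C_t(G)$ is the set of all $t$-cliques of $G$. The clique number $\omega=\omega(G)$ is the number of vertices of a largest clique. For a $t$-clique $I\in C_t(G)$, $\alpha(I)$ is the number of vertices of the largest clique of $G$ containing $I$. An edge is contained in a $t$-clique if both its endpoints belong to that $t$-clique. For $V(G)=[n]=\{1,\dots,n\}$ and $2\le t\le\omega(G)$, the $t$-clique tensor $\mathcal{A}(G)=(a_{i_1i_2\cdots i_t})$ is the $t$-order $n$-dimensional tensor with $a_{i_1\cdots i_t}=\frac{1}{(t-1)!}$ if $\{i_1,\dots,i_t\}\in C_t(G)$ and $a_{i_1\cdots i_t}=0$ otherwise. A number $\lambda\in\mathbb{C}$ is an eigenvalue of a $t$-order $n$-dimensional tensor $\mathcal{A}$ if there is a nonzero $x\in\mathbb{C}^n$ with $\sum_{i_2,\dots,i_t=1}^n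 a_{i i_2\cdots i_t}x_{i_2}\cdots x_{i_t}=\lambda x_i^{t-1}$ for all $i\in[n]$. The spectral radius of $\mathcal{A}$ is the maximum modulus of its eigenvalues, and the $t$-clique spectral radius $\rho_t(G)$ is the spectral radius of the $t$-clique tensor of $G$. A complete $\omega$-partite graph has its vertex set partitioned into $\omega$ nonempty classes, two vertices being adjacent exactly when they lie in different classes; it is called a complete regular $\omega$-partite graph if all classes have the same size. "Possibly together with some isolated vertices" means that the graph is the disjoint union of such a graph and a (possibly empty) set of isolated vertices. *)

theory Defs
  imports Complex_Main "HOL-Library.Disjoint_Sets"
begin

text \<open>A graph is a finite vertex set \<open>V\<close> together with a set \<open>E\<close> of two-element subsets of \<open>V\<close>.\<close>

definition simple_graph :: "'a set \<Rightarrow> 'a set set \<Rightarrow> bool" where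
  "simple_graph V E \<longleftrightarrow> finite V \<and> (\<forall>e\<in>E. e \<subseteq> V \<and> card e = 2)"

definition clique :: "'a set \<Rightarrow> 'a set set \<Rightarrow> 'a set \<Rightarrow> bool" where
  "clique V E K \<longleftrightarrow> K \<subseteq> V \<and> (\<forall>u\<in>K. \<forall>v\<in>K. u \<noteq> v \<longrightarrow> {u, v} \<in> E)"

definition t_cliques :: "'a set \<Rightarrow> 'a set set \<Rightarrow> nat \<Rightarrow> 'a set set" where
  "t_cliques V E t = {K. clique V E K \<and> card K = t}"

definition clique_number :: "'a set \<Rightarrow> 'a set set \<Rightarrow> nat" where
  "clique_number V E = Max {card K | K. clique V E K}"

definition clique_alpha :: "'a set \<Rightarrow> 'a set set \<Rightarrow> 'a set \<Rightarrow> nat" where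
  "clique_alpha V E I = Max {card K | K. clique V E K \<and> I \<subseteq> K}"

text \<open>
  A tensor of order \<open>t\<close> whose indices range over a finite set \<open>V\<close> (so its dimension is \<open>card V\<close>)
  is given by its entries at the lists of length \<open>t\<close> over \<open>V\<close>; vectors are functions on \<open>V\<close>.
  Indexing by the vertices themselves instead of by \<open>{1..n}\<close> avoids choosing a labelling;
  \<open>V = {1..n}\<close> is an instance. Values of tensors and vectors outside \<open>V\<close> play no role.
\<close>

definition tensor_eigenvalue ::
    "'a set \<Rightarrow> nat \<Rightarrow> ('a list \<Rightarrow> complex) \<Rightarrow> complex \<Rightarrow> bool" where
  "tensor_eigenvalue V t a \<mu> \<longleftrightarrow>
     (\<exists>x :: 'a \<Rightarrow> complex. (\<exists>i\<in>V. x i \<noteq> 0) \<and>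
        (\<forall>i\<in>V. (\<Sum>js | set js \<subseteq> V \<and> length js = t - 1. a (i # js) * prod_list (map x js))
                = \<mu> * x i ^ (t - 1)))"

text \<open>
  The maximum modulus; \<open>GREATEST\<close> is used because \<open>Max\<close> would be meaningful only once the
  set of eigenvalues is known to be finite.
\<close>

definition tensor_spectral_radius :: "'a set \<Rightarrow> nat \<Rightarrow> ('a list \<Rightarrow> complex) \<Rightarrow> real" where
  "tensor_spectral_radius V t a = (GREATEST r. \<exists>\<mu>. tensor_eigenvalue V t a \<mu> \<and> r = cmod \<mu>)"

text \<open>A list of length \<open>t\<close> whose set of entries is a \<open>t\<close>-clique has pairwise distinct entries.\<close>

definition clique_tensor :: "'a set \<Rightarrow> 'a set set \<Rightarrow> nat \<Rightarrow> 'a list \<Rightarrow> complex" where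
  "clique_tensor V E t js =
     (if length js = t \<and> set js \<in> t_cliques V E t then 1 / fact (t - 1) else 0)"

definition clique_spectral_radius :: "'a set \<Rightarrow> 'a set set \<Rightarrow> nat \<Rightarrow> real" where
  "clique_spectral_radius V E t = tensor_spectral_radius V t (clique_tensor V E t)"

definition edges_in_t_cliques :: "'a set \<Rightarrow> 'a set set \<Rightarrow> nat \<Rightarrow> 'a set set" where
  "edges_in_t_cliques V E t = {e \<in> E. \<exists>I\<in>t_cliques V E t. e \<subseteq> I}"

definition partite_edges :: "'a set set \<Rightarrow> 'a set set" where
  "partite_edges P = {{u, v} | u v. \<exists>A\<in>P. \<exists>B\<in>P. A \<noteq> B \<and> u \<in> A \<and> v \<in> B}"

definition complete_partite :: "nat \<Rightarrow> 'a set \<Rightarrow> 'a set set \<Rightarrow> bool" where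
  "complete_partite k V E \<longleftrightarrow>
     (\<exists>P. partition_on V P \<and> card P = k \<and> E = partite_edges P)"

definition complete_regular_partite :: "nat \<Rightarrow> 'a set \<Rightarrow> 'a set set \<Rightarrow> bool" where
  "complete_regular_partite k V E \<longleftrightarrow>
     (\<exists>P. partition_on V P \<and> card P = k \<and> E = partite_edges P \<and>
          (\<forall>A\<in>P. \<forall>B\<in>P. card A = card B))"

text \<open>
  The graph \<open>(V, E)\<close> is the disjoint union of a graph \<open>(W, E)\<close> with property \<open>Q\<close> and a possibly
  empty set \<open>S\<close> of isolated vertices. The edge set is unchanged, and \<open>Q W E\<close> is meant to
  entail that all edges lie in \<open>W\<close>.
\<close>

definition up_to_isolated ::
    "('a set \<Rightarrow> 'a set set \<Rightarrow> bool) \<Rightarrow> 'a set \<Rightarrow> 'a set set \<Rightarrow> bool" where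
  "up_to_isolated Q V E \<longleftrightarrow> (\<exists>W S. V = W \<union> S \<and> W \<inter> S = {} \<and> Q W E)"

end

theory Submission
  imports Defs "HOL-Analysis.Function_Topology" "HOL-Combinatorics.Multiset_Permutations"
begin

text \<open>
  Write \<open>x\<^sup>I\<close> for the product of \<open>x\<close> over \<open>I\<close>, \<open>w(a) = (a choose t) / a^t\<close>, and let \<open>\<beta>(I)\<close> be the
  \<open>(t-1)\<close>-st root of \<open>w(\<alpha>(I))\<close>, so that the right-hand side of the bound is \<open>(\<Sum> \<beta>(I))^(t-1)\<close>.

  The clique tensor is symmetric and nonnegative, so by compactness and a Lagrange condition
  \<open>\<rho>\<^sub>t / t\<close> is the maximum of \<open>P(x) = \<Sum> x\<^sup>I\<close> over nonnegative \<open>x\<close> with \<open>\<Sum> x\<^sub>i^t = 1\<close>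
  (\<open>clique_spectral_radius_variational\<close>). Put \<open>y\<^sub>i = x\<^sub>i^t\<close>, a point of the standard simplex.
  The power mean inequality with weights \<open>\<beta>(I)\<close> gives
  \<open>P(x)^t \<le> (\<Sum> \<beta>(I))^(t-1) L(y)\<close> with \<open>L(y) = \<Sum> y\<^sup>I / w(\<alpha>(I))\<close>, and everything reduces to
  \<open>L \<le> 1\<close> on the simplex, a localized Motzkin--Straus inequality (\<open>localized_motzkin_straus\<close>).
  That holds because \<open>L\<close> is affine in the direction that moves weight between two vertices in no
  common \<open>t\<close>-clique: moving all the weight to the better of the two does not decrease \<open>L\<close>, and
  repeating this leads to a point supported on a clique, where \<open>\<alpha>\<close> is at least the size of the
  support and Maclaurin's inequality applies.

  In the case of equality, \<open>L(y) = 1\<close> is a maximum, the support of \<open>y\<close> is the union of the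
  \<open>t\<close>-cliques, and \<open>y\<^sup>I\<close> is proportional to \<open>\<beta>(I)^t\<close>. Maximality makes the partial derivatives of
  \<open>L\<close> agree at two vertices in no common \<open>t\<close>-clique; varying the point within the set of maximizers
  then shows that being in no common \<open>t\<close>-clique is transitive, so the edges in \<open>t\<close>-cliques form a
  complete multipartite graph (\<open>extremal_multipartite\<close>), and its number of parts has to be the clique
  number. Now \<open>\<alpha>\<close> is constant, hence so is \<open>y\<^sup>I\<close>. If there are more than \<open>t\<close> parts, exchanging one
  vertex of a \<open>t\<close>-clique shows that \<open>y\<close> itself is constant. As \<open>L\<close> is an elementary symmetric
  function of the total weights of the parts, the equality case of Maclaurin's inequality makes all
  parts equally large. Conversely, on such a graph the \<open>y\<close> that gives every part the same total
  weight, spread evenly within the part, turns every inequality into an equality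
  (\<open>equality_if_balanced\<close>).
\<close>

section \<open>Elementary symmetric sums and Maclaurin's inequality\<close>

definition esym :: "'a set \<Rightarrow> nat \<Rightarrow> ('a \<Rightarrow> real) \<Rightarrow> real" where
  "esym K t y = (\<Sum>I | I \<subseteq> K \<and> card I = t. \<Prod>i\<in>I. y i)"

lemma esym_0 [simp]: "finite K \<Longrightarrow> esym K 0 y = 1"
proof -
  assume "finite K"
  then have "{I. I \<subseteq> K \<and> card I = 0} = {{}}"
    by (auto dest: finite_subset)
  then show ?thesis by (simp add: esym_def)
qed

lemma esym_cong: "(\<And>i. i \<in> K \<Longrightarrow> y i = z i) \<Longrightarrow> esym K t y = esym K t z"
  unfolding esym_def by (intro sum.cong prod.cong refl) auto

lemma esym_insert:
  assumes "finite K" "u \<notin> K"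
  shows "esym (insert u K) (Suc t) y = esym K (Suc t) y + y u * esym K t y"
proof -
  let ?S = "\<lambda>t. {I. I \<subseteq> K \<and> card I = t}"
  have fin: "finite I" if "I \<subseteq> K" for I
    using that assms(1) finite_subset by blast
  have eq: "{I. I \<subseteq> insert u K \<and> card I = Suc t} = ?S (Suc t) \<union> insert u ` ?S t" (is "?L = ?R")
  proof
    show "?L \<subseteq> ?R"
    proof
      fix I assume I: "I \<in> ?L"
      show "I \<in> ?R"
      proof (cases "u \<in> I")
        case True
        then have "I = insert u (I - {u})" "I - {u} \<subseteq> K" using I by auto
        moreover have "card (I - {u}) = t"
          using I True by simp
        ultimately show ?thesis by blast
      qed (use I in auto)
    qed
    show "?R \<subseteq> ?L"
      using assms fin by (auto simp: card_insert_if)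
  qed
  have inj: "inj_on (insert u) (?S t)"
    using assms(2) by (auto simp: inj_on_def)
  have "esym (insert u K) (Suc t) y
      = (\<Sum>I\<in>?S (Suc t). \<Prod>i\<in>I. y i) + (\<Sum>I\<in>insert u ` ?S t. \<Prod>i\<in>I. y i)"
    unfolding esym_def eq using assms by (intro sum.union_disjoint) auto
  also have "(\<Sum>I\<in>insert u ` ?S t. \<Prod>i\<in>I. y i) = (\<Sum>I\<in>?S t. y u * (\<Prod>i\<in>I. y i))"
    unfolding sum.reindex[OF inj] o_def
  proof (rule sum.cong[OF refl])
    fix I assume "I \<in> ?S t"
    then have "finite I" "u \<notin> I" using fin assms by auto
    then show "(\<Prod>i\<in>insert u I. y i) = y u * (\<Prod>i\<in>I. y i)" by simp
  qed
  finally show ?thesis by (simp add: esym_def sum_distrib_left)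
qed

lemma esym_insert2:
  assumes "finite K" "u \<notin> K" "v \<notin> K" "u \<noteq> v"
  shows "esym (insert u (insert v K)) (Suc (Suc t)) y
    = esym K (Suc (Suc t)) y + (y u + y v) * esym K (Suc t) y + y u * y v * esym K t y"
  using assms by (simp add: esym_insert algebra_simps)

lemma esym_nonneg: "(\<And>i. i \<in> K \<Longrightarrow> 0 \<le> y i) \<Longrightarrow> 0 \<le> esym K t y"
  unfolding esym_def by (intro sum_nonneg prod_nonneg) auto

lemma esym_pos:
  assumes "finite K" "\<And>i. i \<in> K \<Longrightarrow> 0 < y i" "t \<le> card K"
  shows "0 < esym K t y"
proof -
  obtain J where "J \<subseteq> K" "card J = t"
    using obtain_subset_with_card_n[OF assms(3)] by metis
  then show ?thesis
    unfolding esym_def using assms(1,2) by (intro sum_pos prod_pos) auto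
qed

lemma esym_const:
  assumes "finite K" "\<And>i. i \<in> K \<Longrightarrow> y i = c"
  shows "esym K t y = real (card K choose t) * c ^ t"
proof -
  have "(\<Prod>i\<in>I. y i) = c ^ t" if "I \<subseteq> K" "card I = t" for I
  proof -
    have "(\<Prod>i\<in>I. y i) = (\<Prod>i\<in>I. c)"
      using assms(2) that by (intro prod.cong) auto
    then show ?thesis using that by simp
  qed
  then have "esym K t y = (\<Sum>I | I \<subseteq> K \<and> card I = t. c ^ t)"
    unfolding esym_def by (intro sum.cong) auto
  then show ?thesis using n_subsets[OF assms(1)] by simp
qed

lemma esym_change_two:
  assumes "finite K" "u \<in> K" "v \<in> K" "u \<noteq> v" "2 \<le> t" "a + b = y u + y v"
  shows "esym K t (y(u := a, v := b))
    = esym K t y + (a * b - y u * y v) * esym (K - {u, v}) (t - 2) y"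
proof -
  let ?K = "K - {u, v}" and ?y = "y(u := a, v := b)"
  have K: "K = insert u (insert v ?K)" using assms by auto
  obtain s where s: "t = Suc (Suc s)"
    using \<open>2 \<le> t\<close> by (metis Suc_le_D numeral_2_eq_2 Suc_le_mono)
  have same: "esym ?K r ?y = esym ?K r y" for r
    by (rule esym_cong) auto
  have dec: "esym K t z = esym ?K t z + (z u + z v) * esym ?K (Suc s) z + z u * z v * esym ?K s z" for z
    unfolding s by (subst K, rule esym_insert2) (use assms in auto)
  show ?thesis
    unfolding dec same using \<open>u \<noteq> v\<close> \<open>a + b = y u + y v\<close> by (simp add: s algebra_simps)
qed

lemma sum_change_two:
  fixes y :: "'a \<Rightarrow> real"
  assumes "finite K" "u \<in> K" "v \<in> K" "u \<noteq> v" "a + b = y u + y v"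
  shows "sum (y(u := a, v := b)) K = sum y K"
proof -
  have dec: "sum z K = z u + z v + sum z (K - {u, v})" for z :: "'a \<Rightarrow> real"
    using assms by (simp add: sum_diff)
  have "sum (y(u := a, v := b)) (K - {u, v}) = sum y (K - {u, v})"
    by (rule sum.cong) auto
  then show ?thesis unfolding dec using assms by simp
qed

text \<open>
  If the values on \<open>K\<close> are not all equal to their mean \<open>m\<close>, then one of them is below and one
  above \<open>m\<close>. Raising the lower one \<open>y u\<close> to \<open>m\<close> at the expense of the upper one \<open>y v\<close> changes their
  product by \<open>(m - y u) (y v - m) > 0\<close> and puts a further coordinate at the mean.
\<close>
lemma smoothing_step:
  fixes y :: "'a \<Rightarrow> real" and K :: "'a set"
  defines "m \<equiv> sum y K / card K"
  assumes K: "finite K" and nonneg: "\<And>i. i \<in> K \<Longrightarrow> 0 \<le> y i" and "2 \<le> t"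
    and i: "i \<in> K" "y i \<noteq> m"
  obtains z where "\<And>i. i \<in> K \<Longrightarrow> 0 \<le> z i" "sum z K = sum y K"
    "esym K t y \<le> esym K t z" "{i \<in> K. z i \<noteq> m} \<subset> {i \<in> K. y i \<noteq> m}"
proof -
  have "K \<noteq> {}" using i by auto
  then have sm: "sum y K = (\<Sum>i\<in>K. m)"
    using K by (simp add: m_def)
  have "\<exists>u\<in>K. y u < m"
  proof (rule ccontr)
    assume "\<not> ?thesis"
    then have le: "\<forall>j\<in>K. m \<le> y j" by (simp add: not_less)
    then have "m < y i" using i by fastforce
    then have "(\<Sum>i\<in>K. m) < sum y K"
      using le i K by (intro sum_strict_mono_ex1) auto
    then show False using sm by simp
  qed
  then obtain u where u: "u \<in> K" "y u < m" by blast
  have "\<exists>v\<in>K. m < y v"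
  proof (rule ccontr)
    assume "\<not> ?thesis"
    then have le: "\<forall>j\<in>K. y j \<le> m" by (simp add: not_less)
    then have "y i < m" using i by fastforce
    then have "sum y K < (\<Sum>i\<in>K. m)"
      using le i K by (intro sum_strict_mono_ex1) auto
    then show False using sm by simp
  qed
  then obtain v where v: "v \<in> K" "m < y v" by blast
  have uv: "u \<noteq> v" using u v by auto
  define z where "z = y(u := m, v := y u + y v - m)"
  have sz: "sum z K = sum y K"
    unfolding z_def using u v uv K by (intro sum_change_two) auto
  have nn: "0 \<le> z i" if "i \<in> K" for i
    using nonneg[OF that] nonneg[OF u(1)] u v by (auto simp: z_def)
  have "u \<notin> {i \<in> K. z i \<noteq> m}" "u \<in> {i \<in> K. y i \<noteq> m}"
    "{i \<in> K. z i \<noteq> m} \<subseteq> {i \<in> K. y i \<noteq> m}"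
    using u v uv by (auto simp: z_def)
  then have ss: "{i \<in> K. z i \<noteq> m} \<subset> {i \<in> K. y i \<noteq> m}"
    by blast
  have "m * (y u + y v - m) - y u * y v = (m - y u) * (y v - m)"
    by (simp add: algebra_simps)
  then have "esym K t z = esym K t y + (m - y u) * (y v - m) * esym (K - {u, v}) (t - 2) y"
    using esym_change_two[OF K u(1) v(1) uv \<open>2 \<le> t\<close>, of m "y u + y v - m" y]
    by (simp add: z_def)
  moreover have "0 \<le> (m - y u) * (y v - m) * esym (K - {u, v}) (t - 2) y"
    using u v nonneg by (intro mult_nonneg_nonneg esym_nonneg) auto
  ultimately have "esym K t y \<le> esym K t z" by simp
  then show thesis using that nn sz ss by blast
qed

text \<open>
  Each smoothing step lowers the number of coordinates that differ from the mean, so finitely many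
  steps reach the constant vector.
\<close>
lemma maclaurin:
  assumes K: "finite K" and "\<And>i. i \<in> K \<Longrightarrow> 0 \<le> y i" and t: "2 \<le> t"
  shows "esym K t y \<le> real (card K choose t) * (sum y K / card K) ^ t"
proof -
  define m where "m = sum y K / card K"
  have "esym K t z \<le> real (card K choose t) * m ^ t"
    if "card {i \<in> K. z i \<noteq> m} = n" "\<forall>i\<in>K. 0 \<le> z i" "sum z K / card K = m" for n z
    using that
  proof (induction n arbitrary: z rule: less_induct)
    case (less n)
    show ?case
    proof (cases "\<forall>i\<in>K. z i = m")
      case True
      then show ?thesis using esym_const[OF K, of z m t] by simp
    next
      case False
      then obtain i where i: "i \<in> K" "z i \<noteq> sum z K / card K"
        using less.prems(3) by auto
      have nonneg: "\<And>j. j \<in> K \<Longrightarrow> 0 \<le> z j" using less.prems(2) by simp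
      obtain z' where z': "\<And>j. j \<in> K \<Longrightarrow> 0 \<le> z' j" "sum z' K = sum z K"
        "esym K t z \<le> esym K t z'" "{j \<in> K. z' j \<noteq> m} \<subset> {j \<in> K. z j \<noteq> m}"
        using smoothing_step[OF K nonneg t i] unfolding less.prems(3) by blast
      have "card {j \<in> K. z' j \<noteq> m} < card {j \<in> K. z j \<noteq> m}"
        using K z'(4) by (intro psubset_card_mono) auto
      then have "esym K t z' \<le> real (card K choose t) * m ^ t"
        using z'(1,2) less.prems by (intro less.IH[OF _ refl]) simp_all
      then show ?thesis using z'(3) by simp
    qed
  qed
  then show ?thesis using assms(2) by (simp add: m_def)
qed

text \<open>
  Averaging two unequal coordinates gains their product gap times \<open>e\<^sub>t\<^sub>-\<^sub>2\<close> of the other coordinates,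
  and the latter is positive because all coordinates are.
\<close>
lemma maclaurin_strict:
  assumes "finite K" "\<And>i. i \<in> K \<Longrightarrow> 0 < y i" "2 \<le> t" "t \<le> card K"
    and "u \<in> K" "v \<in> K" "y u \<noteq> y v"
  shows "esym K t y < real (card K choose t) * (sum y K / card K) ^ t"
proof -
  define a where "a = (y u + y v) / 2"
  have uv: "u \<noteq> v" using assms by auto
  have "card (K - {u, v}) = card K - 2"
    using assms uv by (simp add: card_Diff_subset)
  then have "0 < esym (K - {u, v}) (t - 2) y"
    using assms by (intro esym_pos) auto
  moreover have "a * a - y u * y v = ((y u - y v) / 2) ^ 2"
    by (simp add: a_def power2_eq_square field_simps)
  then have "0 < a * a - y u * y v"
    using assms(7) by simp
  moreover have "esym K t (y(u := a, v := a))
      = esym K t y + (a * a - y u * y v) * esym (K - {u, v}) (t - 2) y"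
    using assms uv by (intro esym_change_two) (auto simp: a_def)
  moreover have "esym K t (y(u := a, v := a))
      \<le> real (card K choose t) * (sum (y(u := a, v := a)) K / card K) ^ t"
    using assms(1,3) assms(2)[of u] assms(2)[of v] assms(2,5,6)
    by (intro maclaurin) (auto simp: a_def less_imp_le)
  moreover have "sum (y(u := a, v := a)) K = sum y K"
    using assms uv by (intro sum_change_two) (auto simp: a_def)
  ultimately show ?thesis
    by (smt (verit) mult_pos_pos)
qed

section \<open>Multilinear polynomials over a set system\<close>

definition set_poly :: "'a set set \<Rightarrow> ('a set \<Rightarrow> real) \<Rightarrow> ('a \<Rightarrow> real) \<Rightarrow> real" where
  "set_poly C w y = (\<Sum>I\<in>C. w I * (\<Prod>i\<in>I. y i))"

definition set_poly_deriv ::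
    "'a set set \<Rightarrow> ('a set \<Rightarrow> real) \<Rightarrow> 'a \<Rightarrow> ('a \<Rightarrow> real) \<Rightarrow> real" where
  "set_poly_deriv C w u y = (\<Sum>I | I \<in> C \<and> u \<in> I. w I * (\<Prod>i\<in>I - {u}. y i))"

lemma set_poly_cong:
  "(\<And>I i. I \<in> C \<Longrightarrow> i \<in> I \<Longrightarrow> y i = z i) \<Longrightarrow> set_poly C w y = set_poly C w z"
  unfolding set_poly_def by (intro sum.cong arg_cong2[of _ _ _ _ "(*)"] prod.cong refl) auto

lemma set_poly_deriv_cong:
  "(\<And>I i. I \<in> C \<Longrightarrow> u \<in> I \<Longrightarrow> i \<in> I \<Longrightarrow> i \<noteq> u \<Longrightarrow> y i = z i)
    \<Longrightarrow> set_poly_deriv C w u y = set_poly_deriv C w u z"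
  unfolding set_poly_deriv_def
  by (intro sum.cong arg_cong2[of _ _ _ _ "(*)"] prod.cong refl) auto

text \<open>
  Taylor expansion in one coordinate is exact after the linear term, as every monomial is squarefree.
\<close>
lemma set_poly_upd:
  assumes "finite C" "\<And>I. I \<in> C \<Longrightarrow> finite I"
  shows "set_poly C w (y(u := s)) = set_poly C w y + (s - y u) * set_poly_deriv C w u y"
proof -
  have term_eq: "w I * (\<Prod>i\<in>I. (y(u := s)) i)
      = w I * (\<Prod>i\<in>I. y i) + (if u \<in> I then (s - y u) * (w I * (\<Prod>i\<in>I - {u}. y i)) else 0)"
    if "I \<in> C" for I
  proof (cases "u \<in> I")
    case True
    have "(\<Prod>i\<in>I. z i) = z u * (\<Prod>i\<in>I - {u}. z i)" for z :: "'a \<Rightarrow> real"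
      using True assms(2)[OF that] by (simp add: prod.remove)
    moreover have "(\<Prod>i\<in>I - {u}. (y(u := s)) i) = (\<Prod>i\<in>I - {u}. y i)"
      by (intro prod.cong) auto
    ultimately show ?thesis using True by (simp add: algebra_simps)
  next
    case False
    have "(\<Prod>i\<in>I. (y(u := s)) i) = (\<Prod>i\<in>I. y i)"
      using False by (intro prod.cong) auto
    then show ?thesis using False by simp
  qed
  have "set_poly C w (y(u := s)) = set_poly C w y
      + (\<Sum>I\<in>C. if u \<in> I then (s - y u) * (w I * (\<Prod>i\<in>I - {u}. y i)) else 0)"
    unfolding set_poly_def sum.distrib[symmetric] using term_eq by (intro sum.cong) auto
  also have "(\<Sum>I\<in>C. if u \<in> I then (s - y u) * (w I * (\<Prod>i\<in>I - {u}. y i)) else 0)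
      = (s - y u) * set_poly_deriv C w u y"
    unfolding set_poly_deriv_def sum_distrib_left using assms(1)
    by (simp add: sum.inter_filter)
  finally show ?thesis .
qed

text \<open>
  The mixed second derivative in \<open>u\<close> and \<open>v\<close> collects the members of the system that contain both.
  When there are none, the polynomial is affine in the two coordinates jointly.
\<close>
lemma set_poly_upd2:
  assumes "finite C" "\<And>I. I \<in> C \<Longrightarrow> finite I" "u \<noteq> v"
    and "\<And>I. I \<in> C \<Longrightarrow> \<not> (u \<in> I \<and> v \<in> I)"
  shows "set_poly C w (y(u := a, v := b)) = set_poly C w y
    + (a - y u) * set_poly_deriv C w u y + (b - y v) * set_poly_deriv C w v y"
proof -
  have "set_poly_deriv C w v (y(u := a)) = set_poly_deriv C w v y"
    using assms(4) by (intro set_poly_deriv_cong) auto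
  then show ?thesis using assms by (simp add: set_poly_upd)
qed

text \<open>
  Euler's identity for a homogeneous polynomial of degree \<open>t\<close>.
\<close>
lemma sum_mult_set_poly_deriv:
  assumes "finite V" "finite C" "\<And>I. I \<in> C \<Longrightarrow> I \<subseteq> V \<and> card I = t"
  shows "(\<Sum>u\<in>V. y u * set_poly_deriv C w u y) = real t * set_poly C w y"
proof -
  have "(\<Sum>u\<in>V. y u * set_poly_deriv C w u y)
      = (\<Sum>u\<in>V. \<Sum>I\<in>C. if u \<in> I then w I * (\<Prod>i\<in>I. y i) else 0)"
  proof (rule sum.cong[OF refl])
    fix u assume "u \<in> V"
    have "y u * (w I * (\<Prod>i\<in>I - {u}. y i)) = w I * (\<Prod>i\<in>I. y i)" if "I \<in> C" "u \<in> I" for I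
    proof -
      have "finite I" using assms(1,3) that finite_subset by blast
      then show ?thesis using that by (simp add: prod.remove[of I u])
    qed
    then have "y u * set_poly_deriv C w u y = (\<Sum>I | I \<in> C \<and> u \<in> I. w I * (\<Prod>i\<in>I. y i))"
      unfolding set_poly_deriv_def sum_distrib_left by (intro sum.cong) auto
    then show "y u * set_poly_deriv C w u y = (\<Sum>I\<in>C. if u \<in> I then w I * (\<Prod>i\<in>I. y i) else 0)"
      using assms(2) by (simp add: sum.inter_filter)
  qed
  also have "\<dots> = (\<Sum>I\<in>C. \<Sum>u\<in>V. if u \<in> I then w I * (\<Prod>i\<in>I. y i) else 0)"
    by (rule sum.swap)
  also have "\<dots> = (\<Sum>I\<in>C. real t * (w I * (\<Prod>i\<in>I. y i)))"
  proof (rule sum.cong[OF refl])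
    fix I assume "I \<in> C"
    then have "V \<inter> I = I" "card I = t" using assms(3) by auto
    then show "(\<Sum>u\<in>V. if u \<in> I then w I * (\<Prod>i\<in>I. y i) else 0) = real t * (w I * (\<Prod>i\<in>I. y i))"
      using assms(1) by (simp add: sum.If_cases)
  qed
  finally show ?thesis by (simp add: set_poly_def sum_distrib_left)
qed

lemma set_poly_deriv_upd_less:
  assumes "finite C" "\<And>I. I \<in> C \<Longrightarrow> finite I" "\<And>I. I \<in> C \<Longrightarrow> 0 < w I"
    and pos: "\<And>I i. I \<in> C \<Longrightarrow> i \<in> I \<Longrightarrow> 0 < y i"
    and "0 < a" "a < y v" "u \<noteq> v" "J \<in> C" "u \<in> J" "v \<in> J"
  shows "set_poly_deriv C w u (y(v := a)) < set_poly_deriv C w u y"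
  unfolding set_poly_deriv_def
proof (rule sum_strict_mono_ex1)
  show "finite {I \<in> C. u \<in> I}" using assms by simp
  have le: "(y(v := a)) i \<le> y i" "0 < (y(v := a)) i" if "I \<in> C" "i \<in> I" for I i
    using assms pos[OF that] by auto
  show "\<forall>I\<in>{I \<in> C. u \<in> I}. w I * (\<Prod>i\<in>I - {u}. (y(v := a)) i) \<le> w I * (\<Prod>i\<in>I - {u}. y i)"
  proof (intro ballI mult_left_mono prod_mono conjI)
    fix I i assume "I \<in> {I \<in> C. u \<in> I}" "i \<in> I - {u}"
    then have "I \<in> C" "i \<in> I" by auto
    then show "(y(v := a)) i \<le> y i" "0 \<le> (y(v := a)) i"
      using le[of I i] by (simp_all add: less_imp_le)
  qed (use assms(3) in \<open>auto simp: less_imp_le\<close>)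
  have J: "(\<Prod>i\<in>J - {u}. z i) = z v * (\<Prod>i\<in>J - {u} - {v}. z i)" for z :: "'a \<Rightarrow> real"
    using assms by (simp add: prod.remove)
  have "(\<Prod>i\<in>J - {u} - {v}. (y(v := a)) i) = (\<Prod>i\<in>J - {u} - {v}. y i)"
    by (intro prod.cong) auto
  moreover have "0 < (\<Prod>i\<in>J - {u} - {v}. y i)"
    using pos \<open>J \<in> C\<close> by (intro prod_pos) auto
  ultimately have "(\<Prod>i\<in>J - {u}. (y(v := a)) i) < (\<Prod>i\<in>J - {u}. y i)"
    unfolding J using \<open>a < y v\<close> by simp
  then show "\<exists>I\<in>{I \<in> C. u \<in> I}. w I * (\<Prod>i\<in>I - {u}. (y(v := a)) i) < w I * (\<Prod>i\<in>I - {u}. y i)"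
    using assms by (intro bexI[of _ J]) auto
qed

lemma set_poly_nonneg:
  assumes "\<And>I. I \<in> C \<Longrightarrow> 0 \<le> w I" "\<And>I i. I \<in> C \<Longrightarrow> i \<in> I \<Longrightarrow> 0 \<le> y i"
  shows "0 \<le> set_poly C w y"
  unfolding set_poly_def using assms by (intro sum_nonneg mult_nonneg_nonneg prod_nonneg) auto

lemma set_poly_scale:
  assumes "\<And>I. I \<in> C \<Longrightarrow> card I = t"
  shows "set_poly C w (\<lambda>i. c * y i) = c ^ t * set_poly C w y"
  unfolding set_poly_def sum_distrib_left
  using assms by (intro sum.cong) (auto simp: prod.distrib)

section \<open>Cliques and their weights\<close>

lemma finite_cliques: "simple_graph V E \<Longrightarrow> finite {K. clique V E K}"
  by (rule finite_subset[of _ "Pow V"]) (auto simp: clique_def simple_graph_def)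

lemma finite_t_cliques: "simple_graph V E \<Longrightarrow> finite (t_cliques V E t)"
  using finite_cliques by (rule finite_subset[rotated]) (auto simp: t_cliques_def)

lemma t_cliqueD:
  assumes "simple_graph V E" "I \<in> t_cliques V E t"
  shows "clique V E I" "I \<subseteq> V" "card I = t" "finite I"
  using assms finite_subset[of I V] by (auto simp: t_cliques_def clique_def simple_graph_def)

lemma t_clique_vertex: "simple_graph V E \<Longrightarrow> I \<in> t_cliques V E t \<Longrightarrow> i \<in> I \<Longrightarrow> i \<in> V"
  using t_cliqueD(2) by fastforce

lemma clique_subset: "clique V E K \<Longrightarrow> J \<subseteq> K \<Longrightarrow> clique V E J"
  by (auto simp: clique_def)

lemma card_clique_le:
  "simple_graph V E \<Longrightarrow> clique V E K \<Longrightarrow> card K \<le> clique_number V E"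
  unfolding clique_number_def
  by (rule Max_ge) (use finite_cliques in \<open>auto simp: setcompr_eq_image\<close>)

lemma clique_number_attained:
  assumes "simple_graph V E"
  obtains K where "clique V E K" "card K = clique_number V E"
proof -
  have "clique V E {}" by (simp add: clique_def)
  then have "clique_number V E \<in> {card K | K. clique V E K}"
    unfolding clique_number_def
    by (intro Max_in) (use finite_cliques[OF assms] in \<open>auto simp: setcompr_eq_image\<close>)
  then show thesis using that by auto
qed

lemma card_le_clique_alpha:
  assumes "simple_graph V E" "clique V E K" "I \<subseteq> K"
  shows "card K \<le> clique_alpha V E I"
proof -
  have "finite {K. clique V E K \<and> I \<subseteq> K}"
    by (rule finite_subset[OF _ finite_cliques[OF assms(1)]]) auto
  then show ?thesis
    unfolding clique_alpha_def using assms by (intro Max_ge) (auto simp: setcompr_eq_image)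
qed

lemma clique_alpha_le:
  assumes "simple_graph V E" "clique V E I"
  shows "clique_alpha V E I \<le> clique_number V E"
proof -
  have "finite {K. clique V E K \<and> I \<subseteq> K}"
    by (rule finite_subset[OF _ finite_cliques[OF assms(1)]]) auto
  then have "clique_alpha V E I \<in> {card K | K. clique V E K \<and> I \<subseteq> K}"
    unfolding clique_alpha_def
    by (intro Max_in) (use assms in \<open>auto simp: setcompr_eq_image\<close>)
  then show ?thesis using card_clique_le[OF assms(1)] by auto
qed

text \<open>
  The value at the barycentre of an \<open>a\<close>-clique of the sum of all monomials over its \<open>t\<close>-subsets. It
  is therefore the maximum of that sum on the simplex, by Maclaurin's inequality.
\<close>
definition clique_weight :: "nat \<Rightarrow> nat \<Rightarrow> real" where
  "clique_weight t a = real (a choose t) / real a ^ t"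

lemma clique_weight_pos: "t \<le> a \<Longrightarrow> 0 < clique_weight t a"
  by (cases "a = 0") (auto simp: clique_weight_def)

text \<open>
  Up to the factor \<open>1 / t!\<close> the weight is the product of the \<open>1 - i/a\<close> for \<open>i < t\<close>, and none of
  these factors decreases with \<open>a\<close>.
\<close>
lemma clique_weight_mono:
  assumes "t \<le> a" "a \<le> b"
  shows "clique_weight t a \<le> clique_weight t b"
proof (cases "a = 0")
  case False
  have eq: "clique_weight t c = (\<Prod>i = 0..<t. (1 - real i / real c) / real (t - i))"
    if "t \<le> c" "0 < c" for c
  proof -
    have "clique_weight t c = (\<Prod>i = 0..<t. real (c - i) / real (t - i)) / (\<Prod>i = 0..<t. real c)"
      using that by (simp add: clique_weight_def binomial_altdef_of_nat)
    also have "\<dots> = (\<Prod>i = 0..<t. real (c - i) / real (t - i) / real c)"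
      by (rule prod_dividef[symmetric])
    also have "\<dots> = (\<Prod>i = 0..<t. (1 - real i / real c) / real (t - i))"
      using that by (intro prod.cong refl) (auto simp: of_nat_diff field_simps)
    finally show ?thesis .
  qed
  show ?thesis
    using assms False by (auto simp: eq intro!: prod_mono divide_right_mono divide_left_mono mult_pos_pos)
qed (use assms in \<open>simp add: clique_weight_def\<close>)

lemma clique_alpha_bounds:
  assumes "simple_graph V E" "I \<in> t_cliques V E t"
  shows "t \<le> clique_alpha V E I" "clique_alpha V E I \<le> clique_number V E"
  using card_le_clique_alpha[OF assms(1), of I I] clique_alpha_le[OF assms(1)] t_cliqueD[OF assms]
  by auto

section \<open>A localized Motzkin--Straus inequality\<close>

definition clique_lagrangian :: "'a set \<Rightarrow> 'a set set \<Rightarrow> nat \<Rightarrow> ('a \<Rightarrow> real) \<Rightarrow> real" where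
  "clique_lagrangian V E t =
     set_poly (t_cliques V E t) (\<lambda>I. 1 / clique_weight t (clique_alpha V E I))"

text \<open>
  Every \<open>t\<close>-clique \<open>I\<close> that contributes lies in the clique \<open>S\<close>, so \<open>\<alpha>(I)\<close> is at least \<open>card S\<close>.
  Replacing \<open>\<alpha>(I)\<close> by \<open>card S\<close> only increases the coefficients, and it leaves a multiple of an
  elementary symmetric sum on \<open>S\<close>.
\<close>
lemma clique_lagrangian_supported_on_clique:
  assumes "simple_graph V E" "clique V E S" "2 \<le> t"
    and nonneg: "\<And>i. i \<in> S \<Longrightarrow> 0 \<le> y i" and zero: "\<And>i. i \<in> V - S \<Longrightarrow> y i = 0"
  shows "clique_lagrangian V E t y \<le> sum y V ^ t"
proof -
  have SV: "S \<subseteq> V" "finite V" "finite S"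
    using assms by (auto simp: clique_def simple_graph_def intro: finite_subset)
  let ?C = "{I. I \<subseteq> S \<and> card I = t}" and ?w = "\<lambda>I. 1 / clique_weight t (clique_alpha V E I)"
  have sub: "?C \<subseteq> t_cliques V E t"
    using clique_subset[OF assms(2)] by (auto simp: t_cliques_def)
  have "clique_lagrangian V E t y = (\<Sum>I\<in>?C. ?w I * (\<Prod>i\<in>I. y i))"
    unfolding clique_lagrangian_def set_poly_def
  proof (rule sum.mono_neutral_right[OF finite_t_cliques[OF assms(1)] sub], rule ballI)
    fix I assume I: "I \<in> t_cliques V E t - ?C"
    then have "finite I" "I \<subseteq> V" "\<not> I \<subseteq> S"
      using t_cliqueD[OF assms(1), of I t] by auto
    then have "(\<Prod>i\<in>I. y i) = 0"
      using zero by (intro prod_zero) auto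
    then show "?w I * (\<Prod>i\<in>I. y i) = 0" by simp
  qed
  also have "\<dots> \<le> (\<Sum>I\<in>?C. 1 / clique_weight t (card S) * (\<Prod>i\<in>I. y i))"
  proof (rule sum_mono)
    fix I assume I: "I \<in> ?C"
    then have "t \<le> card S" using SV card_mono by blast
    moreover have "card S \<le> clique_alpha V E I"
      using I card_le_clique_alpha[OF assms(1,2)] by auto
    ultimately have "?w I \<le> 1 / clique_weight t (card S)"
      using clique_weight_mono[of t "card S"] clique_weight_pos[of t "card S"]
      by (intro divide_left_mono) (auto intro!: mult_pos_pos elim: less_le_trans)
    then show "?w I * (\<Prod>i\<in>I. y i) \<le> 1 / clique_weight t (card S) * (\<Prod>i\<in>I. y i)"
      using I nonneg by (intro mult_right_mono prod_nonneg) auto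
  qed
  also have "\<dots> = 1 / clique_weight t (card S) * esym S t y"
    by (simp add: esym_def sum_distrib_left)
  also have "\<dots> \<le> sum y S ^ t"
  proof (cases "t \<le> card S")
    case True
    have "esym S t y \<le> real (card S choose t) * (sum y S / card S) ^ t"
      using SV nonneg \<open>2 \<le> t\<close> by (intro maclaurin) auto
    also have "\<dots> = clique_weight t (card S) * sum y S ^ t"
      by (simp add: clique_weight_def power_divide)
    finally show ?thesis
      using clique_weight_pos[OF True] by (simp add: field_simps)
  next
    case False
    then have "?C = {}" using SV card_mono by auto
    then show ?thesis using nonneg by (simp add: esym_def sum_nonneg del: Collect_empty_eq)
  qed
  also have "sum y S = sum y V"
    using SV zero by (intro sum.mono_neutral_left) auto
  finally show ?thesis .
qed

text \<open>
  Induction on the size of the support. Two vertices of the support in no common \<open>t\<close>-clique allow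
  the weight to be concentrated on the one with the larger derivative, which shrinks the support;
  when there is no such pair, the support is a clique.
\<close>
lemma localized_motzkin_straus:
  assumes G: "simple_graph V E" and t: "2 \<le> t" and "\<And>i. i \<in> V \<Longrightarrow> 0 \<le> y i"
  shows "clique_lagrangian V E t y \<le> sum y V ^ t"
proof -
  let ?C = "t_cliques V E t"
  let ?D = "set_poly_deriv ?C (\<lambda>I. 1 / clique_weight t (clique_alpha V E I))"
  have V: "finite V" using G by (simp add: simple_graph_def)
  have "clique_lagrangian V E t z \<le> sum z V ^ t"
    if "card {i \<in> V. z i \<noteq> 0} = n" "\<forall>i\<in>V. 0 \<le> z i" for n z
    using that
  proof (induction n arbitrary: z rule: less_induct)
    case (less n)
    define S where "S = {i \<in> V. z i \<noteq> 0}"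
    show ?case
    proof (cases "\<exists>u\<in>S. \<exists>v\<in>S. u \<noteq> v \<and> (\<forall>I\<in>?C. \<not> (u \<in> I \<and> v \<in> I))")
      case False
      have "clique V E S"
        unfolding clique_def
      proof (intro conjI ballI impI)
        fix u v assume "u \<in> S" "v \<in> S" "u \<noteq> v"
        then obtain I where "I \<in> ?C" "u \<in> I" "v \<in> I" using False by blast
        then show "{u, v} \<in> E"
          using \<open>u \<noteq> v\<close> by (auto simp: t_cliques_def clique_def)
      qed (auto simp: S_def)
      then show ?thesis
        using less.prems by (intro clique_lagrangian_supported_on_clique[OF G _ t]) (auto simp: S_def)
    next
      case True
      have step: "clique_lagrangian V E t z \<le> sum z V ^ t"
        if uv: "u \<in> S" "v \<in> S" "u \<noteq> v" "\<forall>I\<in>?C. \<not> (u \<in> I \<and> v \<in> I)" and D: "?D v z \<le> ?D u z" for u v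
      proof -
        define z' where "z' = z(u := z u + z v, v := 0)"
        have "clique_lagrangian V E t z' = clique_lagrangian V E t z + z v * (?D u z - ?D v z)"
          unfolding clique_lagrangian_def z'_def using uv finite_t_cliques[OF G] t_cliqueD[OF G]
          by (subst set_poly_upd2) (auto simp: algebra_simps)
        moreover have "0 \<le> z v * (?D u z - ?D v z)"
          using less.prems(2) uv D by (auto simp: S_def)
        moreover have "sum z' V = sum z V"
          unfolding z'_def using uv V by (intro sum_change_two) (auto simp: S_def)
        moreover have "clique_lagrangian V E t z' \<le> sum z' V ^ t"
        proof (rule less.IH[OF _ refl])
          have "v \<notin> {i \<in> V. z' i \<noteq> 0}" "{i \<in> V. z' i \<noteq> 0} \<subseteq> S"
            using uv by (auto simp: z'_def S_def)
          then have "{i \<in> V. z' i \<noteq> 0} \<subset> S" using uv(2) by blast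
          then show "card {i \<in> V. z' i \<noteq> 0} < n"
            unfolding less.prems(1)[symmetric] S_def[symmetric]
            using V by (intro psubset_card_mono) (auto simp: S_def)
          show "\<forall>i\<in>V. 0 \<le> z' i"
            using less.prems(2) uv by (auto simp: z'_def S_def)
        qed
        ultimately show ?thesis by simp
      qed
      obtain u v where "u \<in> S" "v \<in> S" "u \<noteq> v" "\<forall>I\<in>?C. \<not> (u \<in> I \<and> v \<in> I)"
        using True by blast
      then show ?thesis
        using step[of u v] step[of v u] by (cases "?D v z \<le> ?D u z") auto
    qed
  qed
  then show ?thesis using assms(3) by blast
qed

section \<open>The spectral radius as a maximum\<close>

abbreviation clique_poly :: "'a set \<Rightarrow> 'a set set \<Rightarrow> nat \<Rightarrow> ('a \<Rightarrow> real) \<Rightarrow> real" where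
  "clique_poly V E t \<equiv> set_poly (t_cliques V E t) (\<lambda>_. 1)"

text \<open>
  A \<open>t\<close>-clique \<open>I\<close> containing \<open>i\<close> is reached by the \<open>(t-1)!\<close> orderings of \<open>I - {i}\<close>, which cancels the
  normalization of the tensor.
\<close>
lemma clique_tensor_apply:
  fixes x :: "'a \<Rightarrow> complex"
  assumes G: "simple_graph V E" and "2 \<le> t" and "i \<in> V"
  shows "(\<Sum>js | set js \<subseteq> V \<and> length js = t - 1.
            clique_tensor V E t (i # js) * prod_list (map x js))
    = (\<Sum>I | I \<in> t_cliques V E t \<and> i \<in> I. \<Prod>j\<in>I - {i}. x j)"
proof -
  let ?T = "{I \<in> t_cliques V E t. i \<in> I}"
  let ?h = "\<lambda>js. clique_tensor V E t (i # js) * prod_list (map x js)"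
  define L where "L = {js. set js \<subseteq> V \<and> length js = t - 1}"
  define L' where "L' = {js \<in> L. set (i # js) \<in> t_cliques V E t}"
  have finL: "finite L"
    unfolding L_def using G by (intro finite_lists_length_eq) (simp add: simple_graph_def)
  have "sum ?h L = sum ?h L'"
    by (rule sum.mono_neutral_right[OF finL]) (auto simp: L'_def clique_tensor_def)
  also have "\<dots> = (\<Sum>I\<in>?T. \<Sum>js\<in>{js \<in> L'. set (i # js) = I}. ?h js)"
    using finL finite_t_cliques[OF G]
    by (intro sum.group[symmetric]) (auto simp: L'_def)
  also have "\<dots> = (\<Sum>I\<in>?T. \<Prod>j\<in>I - {i}. x j)"
  proof (rule sum.cong[OF refl])
    fix I assume "I \<in> ?T"
    then have I: "I \<in> t_cliques V E t" "i \<in> I" "I \<subseteq> V" "card I = t" "finite I"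
      using t_cliqueD[OF G, of I t] by auto
    have cI: "card (I - {i}) = t - 1" using I by simp
    have eq: "{js \<in> L'. set (i # js) = I} = permutations_of_set (I - {i})"
    proof (intro equalityI subsetI)
      fix js assume "js \<in> {js \<in> L'. set (i # js) = I}"
      then have js: "length js = t - 1" "insert i (set js) = I"
        by (auto simp: L'_def L_def)
      have "i \<notin> set js"
      proof
        assume "i \<in> set js"
        then have "card I \<le> t - 1"
          using js card_length[of js] by (simp add: insert_absorb)
        then show False using I(4) \<open>2 \<le> t\<close> by simp
      qed
      then have "set js = I - {i}" using js by auto
      moreover have "distinct js"
        using cI js(1) calculation by (intro card_distinct) simp
      ultimately show "js \<in> permutations_of_set (I - {i})" by auto
    next
      fix js assume "js \<in> permutations_of_set (I - {i})"
      then have js: "set js = I - {i}" "distinct js"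
        by (auto dest: permutations_of_setD)
      then have "length js = t - 1" using cI distinct_card by metis
      moreover have "insert i (set js) = I" using js I by auto
      ultimately show "js \<in> {js \<in> L'. set (i # js) = I}"
        using I js by (auto simp: L'_def L_def)
    qed
    have "(\<Sum>js\<in>{js \<in> L'. set (i # js) = I}. ?h js)
        = (\<Sum>js\<in>permutations_of_set (I - {i}). 1 / fact (t - 1) * (\<Prod>j\<in>I - {i}. x j))"
    proof (rule sum.cong[OF eq])
      fix js assume js: "js \<in> permutations_of_set (I - {i})"
      then have "js \<in> {js \<in> L'. set (i # js) = I}" unfolding eq .
      then have "clique_tensor V E t (i # js) = 1 / fact (t - 1)"
        using I \<open>2 \<le> t\<close> by (auto simp: clique_tensor_def L'_def L_def)
      moreover have "prod_list (map x js) = (\<Prod>j\<in>I - {i}. x j)"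
        using prod.distinct_set_conv_list[of js x] permutations_of_setD[OF js] by simp
      ultimately show "?h js = 1 / fact (t - 1) * (\<Prod>j\<in>I - {i}. x j)" by simp
    qed
    also have "\<dots> = (\<Prod>j\<in>I - {i}. x j)"
      using I cI by simp
    finally show "(\<Sum>js\<in>{js \<in> L'. set (i # js) = I}. ?h js) = (\<Prod>j\<in>I - {i}. x j)" .
  qed
  finally show ?thesis by (simp add: L_def)
qed

text \<open>
  The nonnegative vectors of unit \<open>t\<close>-norm, extended by \<open>0\<close> outside \<open>V\<close> so that they form a closed
  subset of a product of compact sets.
\<close>
lemma compact_unit_power_sphere:
  fixes V :: "'a set"
  assumes "finite V"
  shows "compact ((\<Pi>\<^sub>E i\<in>UNIV. if i \<in> V then {0..1} else {0}) \<inter> {x. (\<Sum>i\<in>V. (x i :: real) ^ t) = 1})"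
proof (rule compact_Int_closed)
  have "compactin (product_topology (\<lambda>_. euclidean) UNIV)
      (\<Pi>\<^sub>E i\<in>(UNIV :: 'a set). if i \<in> V then {0..1} else {0 :: real})"
    unfolding compactin_PiE by auto
  then show "compact (\<Pi>\<^sub>E i\<in>(UNIV :: 'a set). if i \<in> V then {0..1} else {0 :: real})"
    unfolding euclidean_product_topology by simp
  show "closed {x. (\<Sum>i\<in>V. (x i :: real) ^ t) = 1}"
    by (intro closed_Collect_eq continuous_intros continuous_on_product_coordinates)
qed

text \<open>
  A maximizer on the compact sphere also bounds the polynomial at an arbitrary nonnegative vector,
  because both sides of that bound are homogeneous of degree \<open>t\<close>.
\<close>
lemma clique_poly_maximizer:
  fixes V :: "'a set"
  assumes G: "simple_graph V E" and "V \<noteq> {}" and "2 \<le> t"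
  obtains x where "\<And>i. i \<in> V \<Longrightarrow> 0 \<le> x i" "(\<Sum>i\<in>V. x i ^ t) = 1"
    "\<And>z. (\<And>i. i \<in> V \<Longrightarrow> 0 \<le> z i) \<Longrightarrow> clique_poly V E t z \<le> clique_poly V E t x * (\<Sum>i\<in>V. z i ^ t)"
proof -
  let ?P = "clique_poly V E t"
  define S where "S = (\<Pi>\<^sub>E i\<in>(UNIV :: 'a set). if i \<in> V then {0..1} else {0})
      \<inter> {x. (\<Sum>i\<in>V. (x i :: real) ^ t) = 1}"
  have V: "finite V" using G by (simp add: simple_graph_def)
  have restrict: "?P (\<lambda>i. if i \<in> V then z i else 0) = ?P z"
    "(\<Sum>i\<in>V. (if i \<in> V then z i else 0) ^ t) = (\<Sum>i\<in>V. z i ^ t)" for z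
    using t_clique_vertex[OF G] by (auto intro!: set_poly_cong sum.cong)
  have in_S: "(\<lambda>i. if i \<in> V then z i else 0) \<in> S"
    if z: "\<And>i. i \<in> V \<Longrightarrow> 0 \<le> z i" "(\<Sum>i\<in>V. z i ^ t) = 1" for z
  proof -
    have "z i \<le> 1" if "i \<in> V" for i
    proof -
      have "z i ^ t \<le> 1"
        using member_le_sum[of i V "\<lambda>i. z i ^ t"] that z V by simp
      then show ?thesis
        using z(1)[OF that] \<open>2 \<le> t\<close> by (simp add: power_le_one_iff)
    qed
    then show ?thesis
      using z restrict(2)[of z] by (auto simp: S_def PiE_def extensional_def)
  qed
  obtain a where a: "a \<in> V" using \<open>V \<noteq> {}\<close> by auto
  have "(\<Sum>i\<in>V. (if i = a then 1 else 0 :: real) ^ t) = (\<Sum>i\<in>V. if i = a then 1 else 0)"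
    using \<open>2 \<le> t\<close> by (intro sum.cong) auto
  then have "(\<lambda>i. if i \<in> V then if i = a then 1 else 0 else 0) \<in> S"
    using a V by (intro in_S) auto
  then have "S \<noteq> {}" by blast
  moreover have "compact S"
    unfolding S_def using V by (rule compact_unit_power_sphere)
  moreover have "continuous_on S ?P"
    unfolding set_poly_def
    by (intro continuous_intros continuous_on_subset[OF continuous_on_product_coordinates]) auto
  ultimately obtain x where x: "x \<in> S" "\<And>z. z \<in> S \<Longrightarrow> ?P z \<le> ?P x"
    using continuous_attains_sup[of S ?P] by blast
  have pos: "0 \<le> x i" if "i \<in> V" for i
  proof -
    have "x i \<in> (if i \<in> V then {0..1} else {0})"
      using x(1) by (auto simp: S_def PiE_iff)
    then show ?thesis using that by simp
  qed
  have "(\<Sum>i\<in>V. x i ^ t) = 1" using x by (simp add: S_def)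
  moreover have "?P z \<le> ?P x * (\<Sum>i\<in>V. z i ^ t)" if z: "\<And>i. i \<in> V \<Longrightarrow> 0 \<le> z i" for z
  proof (cases "(\<Sum>i\<in>V. z i ^ t) = 0")
    case True
    then have "\<forall>i\<in>V. z i ^ t = 0"
      using z V by (subst (asm) sum_nonneg_eq_0_iff) auto
    then have "\<forall>i\<in>V. z i = 0" by simp
    then have "?P z = ?P (\<lambda>i. 0 * z i)"
      using t_clique_vertex[OF G] by (intro set_poly_cong) auto
    also have "\<dots> = 0 ^ t * ?P z"
      using t_cliqueD[OF G] by (intro set_poly_scale) auto
    finally have "?P z = 0" using \<open>2 \<le> t\<close> by (simp add: power_0_left)
    then show ?thesis using True by simp
  next
    case False
    define s where "s = (\<Sum>i\<in>V. z i ^ t)"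
    have "0 < s" using False z by (simp add: s_def sum_nonneg less_le)
    define c where "c = 1 / root t s"
    have c: "0 < c" "c ^ t = 1 / s"
      using \<open>0 < s\<close> \<open>2 \<le> t\<close> by (simp_all add: c_def power_divide)
    have "(\<Sum>i\<in>V. (c * z i) ^ t) = c ^ t * s"
      by (simp add: s_def power_mult_distrib sum_distrib_left)
    then have "(\<Sum>i\<in>V. (c * z i) ^ t) = 1" using c \<open>0 < s\<close> by simp
    then have "?P (\<lambda>i. if i \<in> V then c * z i else 0) \<le> ?P x"
      using z c by (intro x(2) in_S) simp_all
    then have "?P (\<lambda>i. c * z i) \<le> ?P x" unfolding restrict .
    moreover have "?P (\<lambda>i. c * z i) = c ^ t * ?P z"
      using t_cliqueD[OF G] by (intro set_poly_scale) auto
    ultimately show ?thesis using c \<open>0 < s\<close> by (simp add: s_def field_simps)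
  qed
  ultimately show thesis using that pos by blast
qed

text \<open>
  The first-order condition in one coordinate \<open>a\<close> for the maximum of \<open>s D - M s^t\<close> over \<open>s \<ge> 0\<close>. In
  the interior it is Fermat's rule. At the boundary \<open>a = 0\<close> only \<open>D \<le> 0\<close> would follow in general, which
  is why \<open>D\<close> is assumed to be nonnegative.
\<close>
lemma stationary_coordinate:
  fixes a D M :: real
  assumes min: "\<And>s. 0 \<le> s \<Longrightarrow> (s - a) * D \<le> M * (s ^ t - a ^ t)"
    and "0 \<le> a" "0 \<le> D" "2 \<le> t"
  shows "D = real t * M * a ^ (t - 1)"
proof (cases "a = 0")
  case False
  let ?h = "\<lambda>s. M * s ^ t - D * s"
  have "(?h has_field_derivative (M * (real t * a ^ (t - 1)) - D)) (at a)"
    by (auto intro!: derivative_eq_intros)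
  moreover have "\<forall>s. \<bar>a - s\<bar> < a \<longrightarrow> ?h a \<le> ?h s"
  proof (intro allI impI)
    fix s assume "\<bar>a - s\<bar> < a"
    then have "0 \<le> s" by auto
    then show "?h a \<le> ?h s" using min[of s] by (simp add: algebra_simps)
  qed
  ultimately have "M * (real t * a ^ (t - 1)) - D = 0"
    using False \<open>0 \<le> a\<close> by (intro DERIV_local_min[of ?h _ a a]) auto
  then show ?thesis by (simp add: mult.commute mult.left_commute)
next
  case True
  have "D = 0"
  proof (rule ccontr)
    assume "D \<noteq> 0"
    then have "0 < D" using \<open>0 \<le> D\<close> by simp
    \<comment> \<open>At this small \<open>s\<close> the term \<open>s D\<close> exceeds \<open>M s^t\<close>, as \<open>s^(t-1) \<le> s\<close> and \<open>\<bar>M\<bar> s < D\<close>.\<close>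
    define q where "q = 2 * (\<bar>M\<bar> + 1)"
    define s where "s = min 1 (D / q)"
    have "0 < q" by (simp add: q_def)
    then have s: "0 < s" "s \<le> 1" using \<open>0 < D\<close> by (auto simp: s_def)
    have "s * q \<le> D / q * q"
      using \<open>0 < q\<close> by (intro mult_right_mono) (auto simp: s_def)
    then have sq: "s * q \<le> D" using \<open>0 < q\<close> by simp
    obtain n where n: "t = Suc (Suc n)"
      using \<open>2 \<le> t\<close> by (metis Suc_le_D numeral_2_eq_2 Suc_le_mono)
    have t': "s ^ t = s * s ^ (t - 1)" "s ^ (t - 1) = s * s ^ (t - 2)"
      by (simp_all add: n)
    have "s ^ (t - 1) \<le> s"
      using s power_le_one[of s "t - 2"] unfolding t'(2) by (simp add: mult_left_le)
    have "s * D \<le> M * (s * s ^ (t - 1))"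
      using min[of s] s True by (simp add: n)
    then have "D \<le> M * s ^ (t - 1)" using s(1) by (simp add: algebra_simps)
    also have "\<dots> \<le> \<bar>M\<bar> * s"
      using \<open>s ^ (t - 1) \<le> s\<close> s(1) by (intro mult_mono) auto
    also have "\<dots> < D"
    proof -
      have "s * q = 2 * (\<bar>M\<bar> * s) + 2 * s" by (simp add: q_def algebra_simps)
      moreover have "0 \<le> \<bar>M\<bar> * s" using s by simp
      ultimately show ?thesis using s sq by linarith
    qed
    finally show False by simp
  qed
  then show ?thesis using True \<open>2 \<le> t\<close> by simp
qed

text \<open>
  The maximizer is an eigenvector for the eigenvalue \<open>t P(x)\<close> by its first-order conditions. No
  eigenvalue is larger in modulus: for an eigenvector \<open>y\<close> the triangle inequality yields the
  eigenvalue inequalities for \<open>cmod (y i)\<close>, and multiplying them by \<open>cmod (y i)\<close> and summing gives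
  \<open>t P\<close> by Euler's identity.
\<close>
lemma clique_spectral_radius_variational:
  fixes V :: "'a set"
  assumes G: "simple_graph V E" and "V \<noteq> {}" and t: "2 \<le> t"
  obtains x where "\<And>i. i \<in> V \<Longrightarrow> 0 \<le> x i" "(\<Sum>i\<in>V. x i ^ t) = 1"
    "clique_spectral_radius V E t / t = clique_poly V E t x"
    "\<And>z. (\<And>i. i \<in> V \<Longrightarrow> 0 \<le> z i)
      \<Longrightarrow> clique_poly V E t z \<le> clique_spectral_radius V E t / t * (\<Sum>i\<in>V. z i ^ t)"
proof -
  let ?C = "t_cliques V E t" and ?P = "clique_poly V E t"
  let ?D = "set_poly_deriv ?C (\<lambda>_. 1)"
  have V: "finite V" using G by (simp add: simple_graph_def)
  obtain x where x: "\<And>i. i \<in> V \<Longrightarrow> 0 \<le> x i" "(\<Sum>i\<in>V. x i ^ t) = 1"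
    and max: "\<And>z. (\<And>i. i \<in> V \<Longrightarrow> 0 \<le> z i) \<Longrightarrow> ?P z \<le> ?P x * (\<Sum>i\<in>V. z i ^ t)"
    using clique_poly_maximizer[OF assms] by blast
  have P0: "0 \<le> ?P x"
    using x t_clique_vertex[OF G] by (intro set_poly_nonneg) auto
  have eig: "?D i x = real t * ?P x * x i ^ (t - 1)" if i: "i \<in> V" for i
  proof (rule stationary_coordinate)
    fix s :: real assume "0 \<le> s"
    have "(\<Sum>j\<in>V. (x(i := s)) j ^ t) = s ^ t + (\<Sum>j\<in>V - {i}. (x(i := s)) j ^ t)"
      using i V by (simp add: sum.remove)
    also have "(\<Sum>j\<in>V - {i}. (x(i := s)) j ^ t) = (\<Sum>j\<in>V - {i}. x j ^ t)"
      by (intro sum.cong) auto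
    also have "\<dots> = 1 - x i ^ t"
      using i V x(2) by (simp add: sum.remove)
    finally have s: "(\<Sum>j\<in>V. (x(i := s)) j ^ t) = s ^ t + (1 - x i ^ t)" .
    have "?P (x(i := s)) = ?P x + (s - x i) * ?D i x"
      using finite_t_cliques[OF G] t_cliqueD[OF G] by (intro set_poly_upd) auto
    moreover have "?P (x(i := s)) \<le> ?P x * (\<Sum>j\<in>V. (x(i := s)) j ^ t)"
      using x(1) \<open>0 \<le> s\<close> by (intro max) auto
    ultimately show "(s - x i) * ?D i x \<le> ?P x * (s ^ t - x i ^ t)"
      unfolding s by (simp add: algebra_simps)
  next
    show "0 \<le> ?D i x"
      unfolding set_poly_deriv_def using x(1) t_clique_vertex[OF G]
      by (intro sum_nonneg mult_nonneg_nonneg prod_nonneg) auto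
  qed (use x i t in auto)
  have "tensor_eigenvalue V t (clique_tensor V E t) (of_real (real t * ?P x))"
    unfolding tensor_eigenvalue_def
  proof (intro exI conjI ballI)
    show "\<exists>i\<in>V. complex_of_real (x i) \<noteq> 0"
    proof (rule ccontr)
      assume "\<not> ?thesis"
      then have "(\<Sum>i\<in>V. x i ^ t) = 0" using t by (intro sum.neutral) auto
      then show False using x(2) by simp
    qed
    fix i assume "i \<in> V"
    have "(\<Sum>I | I \<in> ?C \<and> i \<in> I. \<Prod>j\<in>I - {i}. complex_of_real (x j)) = of_real (?D i x)"
      by (simp add: set_poly_deriv_def)
    then show "(\<Sum>js | set js \<subseteq> V \<and> length js = t - 1. clique_tensor V E t (i # js)
        * prod_list (map (\<lambda>i. complex_of_real (x i)) js))
      = of_real (real t * ?P x) * complex_of_real (x i) ^ (t - 1)"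
      unfolding clique_tensor_apply[OF G t \<open>i \<in> V\<close>] eig[OF \<open>i \<in> V\<close>] by simp
  qed
  moreover have "cmod \<mu> \<le> real t * ?P x" if \<mu>: "tensor_eigenvalue V t (clique_tensor V E t) \<mu>" for \<mu>
  proof -
    obtain y where y: "\<exists>i\<in>V. y i \<noteq> 0"
      and ev_tensor: "\<forall>i\<in>V. (\<Sum>js | set js \<subseteq> V \<and> length js = t - 1.
          clique_tensor V E t (i # js) * prod_list (map y js)) = \<mu> * y i ^ (t - 1)"
      using \<mu> unfolding tensor_eigenvalue_def by blast
    have ev: "(\<Sum>I | I \<in> ?C \<and> i \<in> I. \<Prod>j\<in>I - {i}. y j) = \<mu> * y i ^ (t - 1)" if "i \<in> V" for i
      using bspec[OF ev_tensor that] unfolding clique_tensor_apply[OF G t that] .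
    let ?z = "\<lambda>i. cmod (y i)"
    have "cmod \<mu> * ?z i ^ t \<le> ?z i * ?D i ?z" if i: "i \<in> V" for i
    proof -
      have "cmod \<mu> * ?z i ^ (t - 1) = cmod (\<Sum>I | I \<in> ?C \<and> i \<in> I. \<Prod>j\<in>I - {i}. y j)"
        unfolding ev[OF i] by (simp add: norm_mult norm_power)
      also have "\<dots> \<le> ?D i ?z"
        unfolding set_poly_deriv_def by (rule order_trans[OF norm_sum]) (simp add: prod_norm)
      finally have "?z i * (cmod \<mu> * ?z i ^ (t - 1)) \<le> ?z i * ?D i ?z"
        by (intro mult_left_mono) auto
      moreover have "?z i ^ t = ?z i * ?z i ^ (t - 1)"
        using t by (simp add: power_eq_if)
      ultimately show ?thesis by (simp add: algebra_simps)
    qed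
    then have "(\<Sum>i\<in>V. cmod \<mu> * ?z i ^ t) \<le> (\<Sum>i\<in>V. ?z i * ?D i ?z)"
      by (rule sum_mono)
    also have "\<dots> = real t * ?P ?z"
      using V finite_t_cliques[OF G] t_cliqueD[OF G] by (intro sum_mult_set_poly_deriv) auto
    also have "\<dots> \<le> real t * (?P x * (\<Sum>i\<in>V. ?z i ^ t))"
      by (intro mult_left_mono max) auto
    finally have "cmod \<mu> * (\<Sum>i\<in>V. ?z i ^ t) \<le> real t * ?P x * (\<Sum>i\<in>V. ?z i ^ t)"
      by (simp add: sum_distrib_left algebra_simps)
    moreover have "0 < (\<Sum>i\<in>V. ?z i ^ t)"
    proof -
      obtain i where "i \<in> V" "y i \<noteq> 0" using y by blast
      then show ?thesis using V by (intro sum_pos2[of V i]) auto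
    qed
    ultimately show ?thesis by simp
  qed
  moreover have "real t * ?P x = cmod (of_real (real t * ?P x))"
    using P0 by (simp only: norm_of_real abs_of_nonneg mult_nonneg_nonneg of_nat_0_le_iff)
  ultimately have "clique_spectral_radius V E t = real t * ?P x"
    unfolding clique_spectral_radius_def tensor_spectral_radius_def
    by (intro Greatest_equality) blast+
  then have rho: "clique_spectral_radius V E t / t = ?P x" using t by simp
  show thesis
    using that[OF x(1) x(2) rho] max unfolding rho by blast
qed

section \<open>The power mean inequality with a remainder\<close>

text \<open>
  The remainder of the tangent of \<open>z^(n+2)\<close> at \<open>m\<close> satisfies
  \<open>g(n+1) = z g(n) + (n+2) m^(n+1) (z-m)^2\<close>, which makes the quadratic lower bound inductive.
\<close>

lemma power_tangent_gap:
  fixes z m :: real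
  assumes "0 \<le> z" "0 \<le> m"
  shows "real (n + 1) * m ^ n * (z - m)\<^sup>2
    \<le> z ^ (n + 2) - m ^ (n + 2) - real (n + 2) * m ^ (n + 1) * (z - m)"
proof (induction n)
  case 0
  show ?case by (simp add: power2_eq_square algebra_simps)
next
  case (Suc n)
  let ?g = "\<lambda>n. z ^ (n + 2) - m ^ (n + 2) - real (n + 2) * m ^ (n + 1) * (z - m)"
  have "0 \<le> real (n + 1) * m ^ n * (z - m)\<^sup>2" using assms by simp
  then have "0 \<le> ?g n" using Suc.IH by (rule order_trans)
  then have "0 \<le> z * ?g n" using assms by (intro mult_nonneg_nonneg) auto
  moreover have "?g (Suc n) = z * ?g n + real (n + 2) * m ^ (n + 1) * (z - m)\<^sup>2"
    by (simp add: power2_eq_square algebra_simps)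
  ultimately show ?case by simp
qed

text \<open>
  Jensen's inequality for \<open>z^t\<close> with the weights \<open>\<beta>\<close>, cleared of denominators. Keeping the quadratic
  remainder makes the equality case immediate: every \<open>z I\<close> equals the mean \<open>m\<close> as soon as \<open>m\<close> is
  positive.
\<close>
lemma power_mean_gap:
  fixes \<beta> z :: "'b \<Rightarrow> real"
  assumes "finite C" "C \<noteq> {}" "\<And>I. I \<in> C \<Longrightarrow> 0 < \<beta> I" "\<And>I. I \<in> C \<Longrightarrow> 0 \<le> z I" "2 \<le> t"
  defines "B \<equiv> \<Sum>I\<in>C. \<beta> I" and "m \<equiv> (\<Sum>I\<in>C. \<beta> I * z I) / (\<Sum>I\<in>C. \<beta> I)"
  shows "(\<Sum>I\<in>C. \<beta> I * z I) ^ t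
      + B ^ (t - 1) * (real (t - 1) * m ^ (t - 2) * (\<Sum>I\<in>C. \<beta> I * (z I - m)\<^sup>2))
    \<le> B ^ (t - 1) * (\<Sum>I\<in>C. \<beta> I * z I ^ t)"
proof -
  have B: "0 < B" unfolding B_def using assms by (intro sum_pos) auto
  have Bm: "(\<Sum>I\<in>C. \<beta> I * z I) = B * m"
    using B by (simp add: m_def B_def)
  have m: "0 \<le> m"
    unfolding m_def using assms by (intro divide_nonneg_nonneg sum_nonneg mult_nonneg_nonneg) (auto simp: less_imp_le)
  obtain n where n: "t = n + 2" using \<open>2 \<le> t\<close> by (metis add.commute le_Suc_ex)
  have "(\<Sum>I\<in>C. \<beta> I * (m ^ t + real t * m ^ (t - 1) * (z I - m) + real (t - 1) * m ^ (t - 2) * (z I - m)\<^sup>2))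
      \<le> (\<Sum>I\<in>C. \<beta> I * z I ^ t)"
  proof (intro sum_mono mult_left_mono)
    fix I assume "I \<in> C"
    then show "m ^ t + real t * m ^ (t - 1) * (z I - m) + real (t - 1) * m ^ (t - 2) * (z I - m)\<^sup>2 \<le> z I ^ t"
      using power_tangent_gap[of "z I" m n] m assms(4) by (simp add: n algebra_simps)
  qed (use assms in \<open>auto simp: less_imp_le\<close>)
  also have "(\<Sum>I\<in>C. \<beta> I * (m ^ t + real t * m ^ (t - 1) * (z I - m) + real (t - 1) * m ^ (t - 2) * (z I - m)\<^sup>2))
      = B * m ^ t + real t * m ^ (t - 1) * ((\<Sum>I\<in>C. \<beta> I * z I) - B * m)
        + real (t - 1) * m ^ (t - 2) * (\<Sum>I\<in>C. \<beta> I * (z I - m)\<^sup>2)"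
    unfolding B_def
    by (simp add: sum.distrib sum_subtractf sum_distrib_left sum_distrib_right right_diff_distrib
        distrib_left mult.assoc mult.left_commute)
  finally have "B ^ (t - 1) * (B * m ^ t + real (t - 1) * m ^ (t - 2) * (\<Sum>I\<in>C. \<beta> I * (z I - m)\<^sup>2))
      \<le> B ^ (t - 1) * (\<Sum>I\<in>C. \<beta> I * z I ^ t)"
    using B Bm by (intro mult_left_mono) auto
  moreover have "B ^ (t - 1) * (B * m ^ t) = (B * m) ^ t"
    by (simp add: n power_mult_distrib)
  ultimately show ?thesis
    unfolding Bm by (simp add: distrib_left)
qed

section \<open>Transversals of a partition\<close>

definition transversals :: "'a set set \<Rightarrow> nat \<Rightarrow> 'a set set" where
  "transversals P k = {I. I \<subseteq> \<Union>P \<and> finite I \<and> card I = k \<and> (\<forall>A\<in>P. \<forall>u\<in>I \<inter> A. \<forall>v\<in>I \<inter> A. u = v)}"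

lemma transversalsD:
  assumes "I \<in> transversals P k"
  shows "I \<subseteq> \<Union>P" "finite I" "card I = k"
    and "\<And>A u v. A \<in> P \<Longrightarrow> u \<in> I \<Longrightarrow> v \<in> I \<Longrightarrow> u \<in> A \<Longrightarrow> v \<in> A \<Longrightarrow> u = v"
  using assms unfolding transversals_def by auto

lemma transversals_subset:
  assumes "I \<in> transversals P k" "J \<subseteq> I" "J \<subseteq> \<Union>Q" "Q \<subseteq> P"
  shows "J \<in> transversals Q (card J)"
  using assms finite_subset[of J I] unfolding transversals_def by blast

lemma transversals_insert:
  assumes "K \<in> transversals Q k" "Q \<subseteq> P" "A \<in> P - Q" "disjoint P" "u \<in> A"
  shows "insert u K \<in> transversals P (Suc k)" "u \<notin> K"
proof -
  note K = transversalsD[OF assms(1)]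
  have only_A: "B = A" if "B \<in> P" "u \<in> B" for B
    using disjointD[OF assms(4), of B A] that assms(3,5) by blast
  have avoid: "v \<notin> A" if "v \<in> K" for v
  proof
    assume "v \<in> A"
    obtain B where "B \<in> Q" "v \<in> B" using K(1) \<open>v \<in> K\<close> by blast
    then show False
      using disjointD[OF assms(4), of A B] \<open>v \<in> A\<close> assms(2,3) by blast
  qed
  show u: "u \<notin> K" using avoid assms(5) by blast
  have "v = w" if B: "B \<in> P" "v \<in> K" "w \<in> K" "v \<in> B" "w \<in> B" for B v w
  proof -
    obtain B' where B': "B' \<in> Q" "v \<in> B'" using K(1) B(2) by blast
    then have "B' = B" using disjointD[OF assms(4), of B' B] assms(2) B by blast
    then show ?thesis using K(4)[OF B'(1) B(2,3)] B by simp
  qed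
  then have "\<forall>B\<in>P. \<forall>v\<in>insert u K \<inter> B. \<forall>w\<in>insert u K \<inter> B. v = w"
    using only_A avoid by (metis IntD1 IntD2 insertE)
  moreover have "insert u K \<subseteq> \<Union>P" using K(1) assms(2,3,5) by blast
  ultimately show "insert u K \<in> transversals P (Suc k)"
    using K(2,3) u by (simp add: transversals_def)
qed

text \<open>
  Choosing a transversal amounts to choosing \<open>k\<close> blocks and a vertex in each of them. The induction
  over the blocks follows the recursion of \<^const>\<open>esym\<close>: a transversal avoids the new block \<open>A\<close> or
  meets it in exactly one vertex.
\<close>
lemma sum_transversals:
  assumes "finite P" "disjoint P" "\<And>A. A \<in> P \<Longrightarrow> finite A"
  shows "(\<Sum>I\<in>transversals P k. \<Prod>i\<in>I. y i) = esym P k (\<lambda>A. sum y A)"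
  using assms
proof (induction P arbitrary: k rule: finite_induct)
  case empty
  have "transversals ({} :: 'a set set) k = (if k = 0 then {{}} else {})"
    by (auto simp: transversals_def)
  moreover have "{I. I \<subseteq> ({} :: 'a set set) \<and> card I = k} = (if k = 0 then {{}} else {})"
    by auto
  ultimately show ?case by (simp add: esym_def)
next
  case (insert A P)
  have disj: "A \<inter> \<Union>P = {}"
    using insert.prems(1) insert.hyps(2) by (auto simp: pairwise_insert disjnt_def disjoint_def)
  have finA: "finite A" and finU: "finite (\<Union>P)"
    using insert by auto
  have IH: "(\<Sum>I\<in>transversals P k. \<Prod>i\<in>I. y i) = esym P k (\<lambda>A. sum y A)" for k
    using insert.prems by (intro insert.IH) (auto simp: pairwise_insert disjoint_def)
  have finT: "finite (transversals P k)" for k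
    by (rule finite_subset[of _ "Pow (\<Union>P)"]) (use finU in \<open>auto simp: transversals_def\<close>)
  have avoid: "I \<inter> A = {}" if "I \<in> transversals P k" for I k
    using transversalsD(1)[OF that] disj by blast
  show ?case
  proof (cases k)
    case 0
    have "transversals (insert A P) 0 \<subseteq> {{}}"
      using transversalsD(2,3)[of _ "insert A P" 0] by (metis card_0_eq singletonI subsetI)
    moreover have "{} \<in> transversals (insert A P) 0"
      by (simp add: transversals_def)
    ultimately have "transversals (insert A P) 0 = {{}}" by blast
    then show ?thesis using 0 insert.hyps(1) by simp
  next
    case (Suc m)
    let ?ins = "\<lambda>(a, I). insert a I"
    have split: "transversals (insert A P) (Suc m)
        = transversals P (Suc m) \<union> ?ins ` (A \<times> transversals P m)" (is "?L = ?R")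
    proof (intro equalityI subsetI)
      fix I assume I: "I \<in> ?L"
      show "I \<in> ?R"
      proof (cases "I \<inter> A = {}")
        case True
        then have "I \<subseteq> \<Union>P" using transversalsD(1)[OF I] by blast
        then have "I \<in> transversals P (Suc m)"
          using transversals_subset[OF I subset_refl] transversalsD(3)[OF I] by auto
        then show ?thesis by blast
      next
        case False
        then obtain a where a: "a \<in> I" "a \<in> A" by blast
        have "I - {a} \<subseteq> \<Union>P"
          using transversalsD(1,4)[OF I] a by blast
        moreover have "card (I - {a}) = m"
          using transversalsD(3)[OF I] a(1) by simp
        ultimately have "I - {a} \<in> transversals P m"
          using transversals_subset[OF I, of "I - {a}" P] by auto
        moreover have "I = ?ins (a, I - {a})" using a by auto
        ultimately show ?thesis using a by blast
      qed
    next
      fix I assume "I \<in> ?R"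
      then show "I \<in> ?L"
      proof
        assume "I \<in> transversals P (Suc m)"
        then show ?thesis using disj by (auto simp: transversals_def)
      next
        assume "I \<in> ?ins ` (A \<times> transversals P m)"
        then obtain a J where aJ: "a \<in> A" "J \<in> transversals P m" "I = insert a J" by auto
        then show ?thesis
          using transversals_insert(1)[of J P m "insert A P" A a] insert.prems(1) insert.hyps(2)
          by auto
      qed
    qed
    have "(\<Sum>I\<in>?L. \<Prod>i\<in>I. y i) = (\<Sum>I\<in>transversals P (Suc m). \<Prod>i\<in>I. y i)
        + (\<Sum>I\<in>?ins ` (A \<times> transversals P m). \<Prod>i\<in>I. y i)"
      unfolding split
    proof (rule sum.union_disjoint)
      show "transversals P (Suc m) \<inter> ?ins ` (A \<times> transversals P m) = {}"
        using avoid by fast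
    qed (use finT finA in auto)
    also have "(\<Sum>I\<in>?ins ` (A \<times> transversals P m). \<Prod>i\<in>I. y i)
        = (\<Sum>(a, I)\<in>A \<times> transversals P m. y a * (\<Prod>i\<in>I. y i))"
    proof (subst sum.reindex)
      show "inj_on ?ins (A \<times> transversals P m)"
      proof (rule inj_onI, clarify)
        fix a b I J
        assume h: "a \<in> A" "b \<in> A" "I \<in> transversals P m" "J \<in> transversals P m" "insert a I = insert b J"
        have "a \<notin> I" "b \<notin> I" "a \<notin> J" "b \<notin> J"
          using avoid[OF h(3)] avoid[OF h(4)] h(1,2) by blast+
        then have "a = b" using h(5) by blast
        moreover have "I = J" using \<open>a \<notin> I\<close> \<open>b \<notin> J\<close> \<open>a = b\<close> h(5) by (metis insert_ident)
        ultimately show "a = b \<and> I = J" by simp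
      qed
      show "sum ((\<lambda>I. \<Prod>i\<in>I. y i) \<circ> ?ins) (A \<times> transversals P m)
          = (\<Sum>(a, I)\<in>A \<times> transversals P m. y a * (\<Prod>i\<in>I. y i))"
      proof (rule sum.cong[OF refl], clarify)
        fix a I assume "a \<in> A" "I \<in> transversals P m"
        then have "finite I" "a \<notin> I"
          using avoid[of I m] transversalsD(2)[of I P m] by blast+
        then show "((\<lambda>I. \<Prod>i\<in>I. y i) \<circ> ?ins) (a, I) = y a * (\<Prod>i\<in>I. y i)" by simp
      qed
    qed
    also have "\<dots> = sum y A * (\<Sum>I\<in>transversals P m. \<Prod>i\<in>I. y i)"
      by (simp add: sum_product sum.cartesian_product)
    finally show ?thesis
      unfolding Suc IH using insert.hyps by (simp add: esym_insert)
  qed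
qed

lemma card_transversal_le:
  assumes "finite P" "I \<in> transversals P k"
  shows "k \<le> card P"
proof -
  note I = transversalsD[OF assms(2)]
  have "\<forall>i\<in>I. \<exists>A. A \<in> P \<and> i \<in> A" using I(1) by blast
  then obtain b where b: "\<forall>i\<in>I. b i \<in> P \<and> i \<in> b i" unfolding bchoice_iff by blast
  have "inj_on b I"
    by (rule inj_onI) (metis I(4) b)
  then have "card I \<le> card P"
    using b assms(1) by (intro card_inj_on_le[of b]) auto
  then show ?thesis using I(3) by simp
qed

lemma transversal_extend:
  assumes "finite P" "disjoint P" "{} \<notin> P" "I \<in> transversals P k"
  obtains K where "I \<subseteq> K" "K \<in> transversals P (card P)"
proof -
  have "\<forall>A\<in>P. \<exists>a\<in>A. \<forall>i\<in>I \<inter> A. i = a"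
  proof
    fix A assume A: "A \<in> P"
    show "\<exists>a\<in>A. \<forall>i\<in>I \<inter> A. i = a"
    proof (cases "I \<inter> A = {}")
      case True
      then show ?thesis using A assms(3) by auto
    next
      case False
      then obtain a where a: "a \<in> I" "a \<in> A" by blast
      then have "\<forall>i\<in>I \<inter> A. i = a" using transversalsD(4)[OF assms(4) A] by blast
      then show ?thesis using a by blast
    qed
  qed
  then obtain r where "\<forall>A\<in>P. r A \<in> A \<and> (\<forall>i\<in>I \<inter> A. i = r A)"
    unfolding bchoice_iff Bex_def by blast
  then have r: "\<And>A. A \<in> P \<Longrightarrow> r A \<in> A" "\<And>A i. A \<in> P \<Longrightarrow> i \<in> I \<Longrightarrow> i \<in> A \<Longrightarrow> i = r A"
    by blast+
  have same: "A = B" if "A \<in> P" "B \<in> P" "r A \<in> B" for A B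
    using assms(2) r(1)[OF that(1)] that by (auto simp: disjoint_def)
  have "inj_on r P"
    by (rule inj_onI) (metis same r(1))
  then have "card (r ` P) = card P" by (rule card_image)
  moreover have "r ` P \<subseteq> \<Union>P" using r(1) by auto
  moreover have "\<forall>A\<in>P. \<forall>u\<in>r ` P \<inter> A. \<forall>v\<in>r ` P \<inter> A. u = v"
    using same by blast
  ultimately have "r ` P \<in> transversals P (card P)"
    using assms(1) by (simp add: transversals_def)
  moreover have "I \<subseteq> r ` P"
    using r(2) transversalsD(1)[OF assms(4)] by blast
  ultimately show thesis using that by blast
qed

lemma partite_edgesE:
  assumes "e \<in> partite_edges P"
  obtains u v A B where "e = {u, v}" "A \<in> P" "B \<in> P" "A \<noteq> B" "u \<in> A" "v \<in> B"
  using assms unfolding partite_edges_def by blast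

lemma partite_edges_iff:
  "{u, v} \<in> partite_edges P \<longleftrightarrow> (\<exists>A\<in>P. \<exists>B\<in>P. A \<noteq> B \<and> u \<in> A \<and> v \<in> B)"
proof
  assume "{u, v} \<in> partite_edges P"
  then obtain a b A B where "{u, v} = {a, b}" "A \<in> P" "B \<in> P" "A \<noteq> B" "a \<in> A" "b \<in> B"
    by (rule partite_edgesE)
  moreover have "u = a \<and> v = b \<or> u = b \<and> v = a"
    using calculation(1) by (simp add: doubleton_eq_iff)
  ultimately show "\<exists>A\<in>P. \<exists>B\<in>P. A \<noteq> B \<and> u \<in> A \<and> v \<in> B" by blast
next
  assume "\<exists>A\<in>P. \<exists>B\<in>P. A \<noteq> B \<and> u \<in> A \<and> v \<in> B"
  then show "{u, v} \<in> partite_edges P"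
    unfolding partite_edges_def by blast
qed

section \<open>Graphs whose edges in \<open>t\<close>-cliques form a complete multipartite graph\<close>

locale t_clique_multipartite =
  fixes V :: "'a set" and E :: "'a set set" and t :: nat and W :: "'a set" and P :: "'a set set"
  assumes graph: "simple_graph V E" and t_ge: "2 \<le> t" and t_le: "t \<le> clique_number V E"
    and sub: "W \<subseteq> V" and part: "partition_on W P"
    and edges: "edges_in_t_cliques V E t = partite_edges P"
begin

lemma finite_W: "finite W"
  using graph sub finite_subset by (auto simp: simple_graph_def)

lemma finite_P: "finite P"
  using finite_elements[OF finite_W part] .

lemma disjoint_P: "disjoint P" and Union_P: "\<Union>P = W" and nonempty_P: "{} \<notin> P"
  using part by (simp_all add: partition_on_def)

lemma finite_block: "A \<in> P \<Longrightarrow> finite A"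
  using finite_subset[OF _ finite_W, of A] Union_upper[of A P] Union_P by simp

lemma transversal_clique:
  assumes "K \<in> transversals P k"
  shows "clique V E K"
  unfolding clique_def
proof (intro conjI ballI impI)
  show "K \<subseteq> V" using assms sub Union_P by (auto simp: transversals_def)
  fix u v assume uv: "u \<in> K" "v \<in> K" "u \<noteq> v"
  then obtain A B where "A \<in> P" "B \<in> P" "u \<in> A" "v \<in> B"
    using transversalsD(1)[OF assms] by blast
  moreover have "A \<noteq> B" using transversalsD(4)[OF assms] uv calculation by blast
  ultimately have "{u, v} \<in> edges_in_t_cliques V E t"
    unfolding edges partite_edges_iff by blast
  then show "{u, v} \<in> E" by (simp add: edges_in_t_cliques_def)
qed

text \<open>
  For \<open>s \<ge> t\<close> any two vertices of an \<open>s\<close>-clique lie in a common \<open>t\<close>-clique, so its edges are among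
  those described by the partition. The case \<open>s > t\<close> is what makes maximum cliques of the whole
  graph visible in the partition.
\<close>
lemma t_cliques_eq_transversals:
  assumes "t \<le> s"
  shows "t_cliques V E s = transversals P s"
proof (intro equalityI subsetI)
  fix K assume "K \<in> transversals P s"
  then show "K \<in> t_cliques V E s"
    using transversal_clique by (auto simp: t_cliques_def transversals_def)
next
  fix K assume K: "K \<in> t_cliques V E s"
  note K' = t_cliqueD[OF graph K]
  have edge: "\<exists>A\<in>P. \<exists>B\<in>P. A \<noteq> B \<and> u \<in> A \<and> v \<in> B" if uv: "u \<in> K" "v \<in> K" "u \<noteq> v" for u v
  proof -
    have "card {u, v} \<le> t" "{u, v} \<subseteq> K" using uv t_ge by auto
    then obtain J where J: "{u, v} \<subseteq> J" "J \<subseteq> K" "card J = t"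
      using exists_subset_between[of "{u, v}" t K] assms K' by auto
    then have "J \<in> t_cliques V E t"
      using K' clique_subset by (auto simp: t_cliques_def)
    moreover have "{u, v} \<in> E" using K'(1) uv by (auto simp: clique_def)
    ultimately have "{u, v} \<in> partite_edges P"
      unfolding edges[symmetric] edges_in_t_cliques_def using J(1) by blast
    then show ?thesis by (simp add: partite_edges_iff)
  qed
  have "u \<in> \<Union>P" if "u \<in> K" for u
  proof -
    have "K \<noteq> {u}" using K' assms t_ge by auto
    then obtain v where "v \<in> K" "v \<noteq> u" using \<open>u \<in> K\<close> by blast
    then show ?thesis using edge[OF \<open>u \<in> K\<close>] by blast
  qed
  moreover have "u = v" if A: "A \<in> P" "u \<in> K" "v \<in> K" "u \<in> A" "v \<in> A" for A u v
  proof (rule ccontr)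
    assume "u \<noteq> v"
    then obtain B B' where "B \<in> P" "B' \<in> P" "B \<noteq> B'" "u \<in> B" "v \<in> B'"
      using edge[OF A(2,3)] by blast
    moreover have "B = A" "B' = A"
      using disjointD[OF disjoint_P, of B A] disjointD[OF disjoint_P, of B' A] calculation A by blast+
    ultimately show False by simp
  qed
  ultimately show "K \<in> transversals P s"
    using K' by (auto simp: transversals_def)
qed

text \<open>
  A full transversal is a clique, and a maximum clique meets every block at most once.
\<close>
lemma card_blocks: "card P = clique_number V E"
proof (rule antisym)
  have "{} \<in> transversals P 0" by (simp add: transversals_def)
  then obtain K where "K \<in> transversals P (card P)"
    using transversal_extend[OF finite_P disjoint_P nonempty_P] by metis
  then show "card P \<le> clique_number V E"
    using card_clique_le[OF graph transversal_clique] transversalsD(3) by metis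
  obtain K where "clique V E K" "card K = clique_number V E"
    using clique_number_attained[OF graph] .
  then have "K \<in> t_cliques V E (clique_number V E)" by (simp add: t_cliques_def)
  then show "clique_number V E \<le> card P"
    using t_cliques_eq_transversals[OF t_le] card_transversal_le[OF finite_P] by blast
qed

text \<open>
  A \<open>t\<close>-clique is a partial transversal, and it extends to a full one, which is a maximum clique.
\<close>
lemma clique_alpha_eq:
  assumes "I \<in> t_cliques V E t"
  shows "clique_alpha V E I = clique_number V E"
proof (rule antisym)
  show "clique_alpha V E I \<le> clique_number V E"
    by (rule clique_alpha_bounds(2)[OF graph assms])
  have "I \<in> transversals P t" using assms t_cliques_eq_transversals by simp
  then obtain K where "I \<subseteq> K" "K \<in> transversals P (card P)"
    using transversal_extend[OF finite_P disjoint_P nonempty_P] by metis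
  then show "clique_number V E \<le> clique_alpha V E I"
    using card_le_clique_alpha[OF graph transversal_clique] card_blocks transversalsD(3) by metis
qed

text \<open>
  All \<open>\<alpha>(I)\<close> equal the clique number here, so the coefficients are constant and only the total
  weights of the blocks matter.
\<close>
lemma clique_lagrangian_eq_esym:
  "clique_lagrangian V E t y = esym P t (\<lambda>A. sum y A) / clique_weight t (clique_number V E)"
proof -
  have "clique_lagrangian V E t y
      = (\<Sum>I\<in>transversals P t. 1 / clique_weight t (clique_number V E) * (\<Prod>i\<in>I. y i))"
    unfolding clique_lagrangian_def set_poly_def
    using clique_alpha_eq by (intro sum.cong) (simp_all add: t_cliques_eq_transversals)
  then show ?thesis
    using sum_transversals[OF finite_P disjoint_P finite_block] by (simp flip: sum_divide_distrib)
qed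

end

section \<open>Maximizers of the clique Lagrangian\<close>

lemma lagrangian_weight_pos:
  assumes "simple_graph V E" "I \<in> t_cliques V E t"
  shows "0 < 1 / clique_weight t (clique_alpha V E I)"
  using clique_weight_pos[OF clique_alpha_bounds(1)[OF assms]] by simp

abbreviation lagrangian_deriv :: "'a set \<Rightarrow> 'a set set \<Rightarrow> nat \<Rightarrow> 'a \<Rightarrow> ('a \<Rightarrow> real) \<Rightarrow> real" where
  "lagrangian_deriv V E t \<equiv>
     set_poly_deriv (t_cliques V E t) (\<lambda>I. 1 / clique_weight t (clique_alpha V E I))"

lemma lagrangian_shift:
  assumes "simple_graph V E" "u \<noteq> v" "\<And>I. I \<in> t_cliques V E t \<Longrightarrow> \<not> (u \<in> I \<and> v \<in> I)"
    and "a + b = y u + y v"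
  shows "clique_lagrangian V E t (y(u := a, v := b)) = clique_lagrangian V E t y
    + (a - y u) * (lagrangian_deriv V E t u y - lagrangian_deriv V E t v y)"
proof -
  have b: "b - y v = - (a - y u)" using assms(4) by simp
  show ?thesis
    unfolding clique_lagrangian_def
    using finite_t_cliques[OF assms(1)] t_cliqueD(4)[OF assms(1)] assms(2,3)
    by (subst set_poly_upd2) (auto simp: b algebra_simps)
qed

text \<open>
  The Lagrangian is affine along the segment that exchanges weight between \<open>u\<close> and \<open>v\<close>. As it is
  maximal at an interior point of that segment, its slope vanishes.
\<close>
lemma extremal_deriv_eq:
  assumes G: "simple_graph V E" and t: "2 \<le> t" and nonneg: "\<And>i. i \<in> V \<Longrightarrow> 0 \<le> y i"
    and ext: "clique_lagrangian V E t y = sum y V ^ t"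
    and uv: "u \<in> V" "v \<in> V" "u \<noteq> v" "0 < y u" "0 < y v"
    and nonadj: "\<And>I. I \<in> t_cliques V E t \<Longrightarrow> \<not> (u \<in> I \<and> v \<in> I)"
  shows "lagrangian_deriv V E t u y = lagrangian_deriv V E t v y"
proof -
  let ?d = "lagrangian_deriv V E t u y - lagrangian_deriv V E t v y"
  have V: "finite V" using G by (simp add: simple_graph_def)
  have "(a - y u) * ?d \<le> 0" if ab: "0 \<le> a" "0 \<le> b" "a + b = y u + y v" for a b
  proof -
    have "clique_lagrangian V E t (y(u := a, v := b)) \<le> sum (y(u := a, v := b)) V ^ t"
      using nonneg ab by (intro localized_motzkin_straus[OF G t]) auto
    also have "\<dots> = clique_lagrangian V E t y"
      using sum_change_two[OF V uv(1-3) ab(3)] ext by simp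
    finally show ?thesis
      using lagrangian_shift[OF G uv(3) nonadj ab(3)] by simp
  qed
  from this[of "y u + y v" 0] this[of 0 "y u + y v"] have "y v * ?d \<le> 0" "- y u * ?d \<le> 0"
    using uv by simp_all
  then show ?thesis
    using uv(4,5) by (simp add: mult_le_0_iff zero_le_mult_iff)
qed

text \<open>
  Halve the weight of \<open>w\<close> in favour of \<open>v\<close>. The Lagrangian does not change, so the derivatives at \<open>u\<close>
  and \<open>v\<close> agree both before and after. The derivative at \<open>v\<close> involves neither \<open>y v\<close> nor \<open>y w\<close> and
  stays the same, whereas the one at \<open>u\<close> would drop strictly if \<open>u\<close> and \<open>w\<close> were in a common
  \<open>t\<close>-clique.
\<close>
lemma extremal_nonadjacent_trans:
  assumes G: "simple_graph V E" and t: "2 \<le> t" and nonneg: "\<And>i. i \<in> V \<Longrightarrow> 0 \<le> y i"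
    and ext: "clique_lagrangian V E t y = sum y V ^ t"
    and pos: "\<And>I i. I \<in> t_cliques V E t \<Longrightarrow> i \<in> I \<Longrightarrow> 0 < y i"
    and V: "u \<in> V" "v \<in> V" "w \<in> V" and ne: "u \<noteq> v" "v \<noteq> w" "u \<noteq> w"
    and y: "0 < y u" "0 < y v" "0 < y w"
    and uv: "\<And>I. I \<in> t_cliques V E t \<Longrightarrow> \<not> (u \<in> I \<and> v \<in> I)"
    and vw: "\<And>I. I \<in> t_cliques V E t \<Longrightarrow> \<not> (v \<in> I \<and> w \<in> I)"
    and J: "J \<in> t_cliques V E t"
  shows "\<not> (u \<in> J \<and> w \<in> J)"
proof
  assume uw: "u \<in> J \<and> w \<in> J"
  let ?D = "lagrangian_deriv V E t"
  have fV: "finite V" using G by (simp add: simple_graph_def)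
  have wv: "\<And>I. I \<in> t_cliques V E t \<Longrightarrow> \<not> (w \<in> I \<and> v \<in> I)" using vw by blast
  define y' where "y' = y(w := y w / 2, v := y v + y w / 2)"
  have "?D w y = ?D v y"
    using extremal_deriv_eq[OF G t nonneg ext V(3,2) ne(2)[symmetric] y(3,2) wv] .
  then have "clique_lagrangian V E t y' = clique_lagrangian V E t y"
    unfolding y'_def using lagrangian_shift[OF G ne(2)[symmetric] wv, where a = "y w / 2" and b = "y v + y w / 2"]
    by simp
  moreover have "sum y' V = sum y V"
    unfolding y'_def using sum_change_two[OF fV V(3,2) ne(2)[symmetric]] by simp
  ultimately have ext': "clique_lagrangian V E t y' = sum y' V ^ t" using ext by simp
  have nonneg': "0 \<le> y' i" if "i \<in> V" for i
    using nonneg[OF that] y by (simp add: y'_def)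
  have y': "0 < y' u" "0 < y' v" using y ne by (simp_all add: y'_def)
  have "?D u y' = ?D v y'"
    using extremal_deriv_eq[OF G t nonneg' ext' V(1,2) ne(1) y' uv] .
  also have "?D v y' = ?D v y"
    using vw by (intro set_poly_deriv_cong) (auto simp: y'_def)
  also have "\<dots> = ?D u y"
    using extremal_deriv_eq[OF G t nonneg ext V(1,2) ne(1) y(1,2) uv] by simp
  finally have "?D u y' = ?D u y" .
  moreover have "?D u y' = ?D u (y(w := y w / 2))"
    using uv by (intro set_poly_deriv_cong) (auto simp: y'_def)
  moreover have "?D u (y(w := y w / 2)) < ?D u y"
    using uw J pos y ne(3) finite_t_cliques[OF G] t_cliqueD(4)[OF G] lagrangian_weight_pos[OF G]
    by (intro set_poly_deriv_upd_less) auto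
  ultimately show False by simp
qed

text \<open>
  Being equal or in no common \<open>t\<close>-clique is an equivalence relation on the vertices in \<open>t\<close>-cliques,
  and its classes are the parts.
\<close>
lemma extremal_multipartite:
  assumes G: "simple_graph V E" and t: "2 \<le> t" "t \<le> clique_number V E"
    and nonneg: "\<And>i. i \<in> V \<Longrightarrow> 0 \<le> y i"
    and ext: "clique_lagrangian V E t y = sum y V ^ t"
    and pos: "\<And>I i. I \<in> t_cliques V E t \<Longrightarrow> i \<in> I \<Longrightarrow> 0 < y i"
  obtains P where "t_clique_multipartite V E t (\<Union>(t_cliques V E t)) P"
proof -
  let ?C = "t_cliques V E t"
  define W where "W = \<Union>?C"
  define R where "R = {(u, v). u \<in> W \<and> v \<in> W \<and> (u = v \<or> (\<forall>I\<in>?C. \<not> (u \<in> I \<and> v \<in> I)))}"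
  have WV: "W \<subseteq> V" using t_clique_vertex[OF G] by (auto simp: W_def)
  have posW: "0 < y i" if "i \<in> W" for i using that pos by (auto simp: W_def)
  have "trans R"
  proof (rule transI)
    fix u v w assume "(u, v) \<in> R" "(v, w) \<in> R"
    then have W: "u \<in> W" "v \<in> W" "w \<in> W"
      and uv: "u = v \<or> (\<forall>I\<in>?C. \<not> (u \<in> I \<and> v \<in> I))"
      and vw: "v = w \<or> (\<forall>I\<in>?C. \<not> (v \<in> I \<and> w \<in> I))"
      by (auto simp: R_def)
    show "(u, w) \<in> R"
    proof (cases "u = v \<or> v = w \<or> u = w")
      case True
      then show ?thesis using W uv vw by (auto simp: R_def)
    next
      case False
      have "\<not> (u \<in> J \<and> w \<in> J)" if J: "J \<in> ?C" for J
        by (rule extremal_nonadjacent_trans[OF G t(1) nonneg ext pos, where v = v])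
          (use False uv vw W WV posW J in auto)
      then show ?thesis using W by (auto simp: R_def)
    qed
  qed
  moreover have "refl_on W R" "sym R" "R \<subseteq> W \<times> W"
    by (auto simp: R_def refl_on_def sym_def)
  ultimately have equiv: "equiv W R" by (simp add: equiv_def)
  have part: "partition_on W (W // R)" by (rule partition_on_quotient[OF equiv])
  have edges: "edges_in_t_cliques V E t = partite_edges (W // R)"
  proof (intro equalityI subsetI)
    fix e assume "e \<in> edges_in_t_cliques V E t"
    then obtain I where I: "e \<in> E" "I \<in> ?C" "e \<subseteq> I"
      by (auto simp: edges_in_t_cliques_def)
    then have "card e = 2" using G by (simp add: simple_graph_def)
    then obtain u v where e: "e = {u, v}" "u \<noteq> v" by (auto simp: card_2_iff)
    have W: "u \<in> W" "v \<in> W" using I e by (auto simp: W_def)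
    have "(u, v) \<notin> R" using I e by (auto simp: R_def)
    then have "R `` {u} \<noteq> R `` {v}"
      using W eq_equiv_class_iff[OF equiv] by blast
    moreover have "u \<in> R `` {u}" "v \<in> R `` {v}"
      using W by (auto simp: R_def)
    ultimately show "e \<in> partite_edges (W // R)"
      unfolding e partite_edges_iff
      by (intro bexI[where x = "R `` {u}"] bexI[where x = "R `` {v}"])
        (simp_all add: quotientI W)
  next
    fix e assume "e \<in> partite_edges (W // R)"
    then obtain u v A B where e: "e = {u, v}" "A \<in> W // R" "B \<in> W // R" "A \<noteq> B" "u \<in> A" "v \<in> B"
      by (rule partite_edgesE)
    have W: "u \<in> W" "v \<in> W"
      using Union_quotient[OF equiv] UnionI[OF e(2,5)] UnionI[OF e(3,6)] by simp_all
    have "(u, v) \<notin> R"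
      using e(4) quotient_eqI[OF equiv e(2,3,5,6)] by fast
    then have "u \<noteq> v" and "\<exists>I\<in>?C. u \<in> I \<and> v \<in> I"
      using W by (auto simp: R_def)
    then obtain I where I: "I \<in> ?C" "u \<in> I" "v \<in> I" by blast
    then have "{u, v} \<in> E"
      using t_cliqueD(1)[OF G I(1)] \<open>u \<noteq> v\<close> by (simp add: clique_def)
    then show "e \<in> edges_in_t_cliques V E t"
      using I e(1) by (auto simp: edges_in_t_cliques_def)
  qed
  have "t_clique_multipartite V E t W (W // R)"
    using G t WV part edges by unfold_locales
  then show thesis using that by (simp add: W_def)
qed

section \<open>The bound and its equality case\<close>

definition clique_root_sum :: "'a set \<Rightarrow> 'a set set \<Rightarrow> nat \<Rightarrow> real" where
  "clique_root_sum V E t =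
     (\<Sum>I\<in>t_cliques V E t. root (t - 1) (clique_weight t (clique_alpha V E I)))"

lemma t_cliques_nonempty:
  assumes "simple_graph V E" "t \<le> clique_number V E"
  shows "t_cliques V E t \<noteq> {}"
proof -
  obtain K where K: "clique V E K" "card K = clique_number V E"
    using clique_number_attained[OF assms(1)] .
  then obtain I where "I \<subseteq> K" "card I = t"
    using obtain_subset_with_card_n[of t K] assms(2) by metis
  then have "I \<in> t_cliques V E t"
    using clique_subset[OF K(1)] by (simp add: t_cliques_def)
  then show ?thesis by blast
qed

text \<open>
  The power mean inequality is applied to \<open>z I = x\<^sup>I / \<beta>(I)\<close> at a maximizer \<open>x\<close>. Then \<open>\<beta>(I) z I\<close> sums to
  \<open>P(x)\<close> and \<open>\<beta>(I) (z I)^t = y\<^sup>I / w(\<alpha>(I))\<close> sums to the Lagrangian of \<open>y = x^t\<close>. Equality forces all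
  \<open>z I\<close> to agree; their common value is the \<open>m\<close> of the statement.
\<close>
lemma spectral_radius_le_lagrangian:
  assumes G: "simple_graph V E" and t: "2 \<le> t" "t \<le> clique_number V E"
  obtains y m where "\<And>i. i \<in> V \<Longrightarrow> 0 \<le> y i" "sum y V = 1"
    "(clique_spectral_radius V E t / t) ^ t \<le> clique_root_sum V E t ^ (t - 1) * clique_lagrangian V E t y"
    "(clique_spectral_radius V E t / t) ^ t = clique_root_sum V E t ^ (t - 1) \<Longrightarrow>
       0 < m \<and> (\<forall>I\<in>t_cliques V E t.
         (\<Prod>i\<in>I. y i) = (m * root (t - 1) (clique_weight t (clique_alpha V E I))) ^ t)"
proof -
  let ?C = "t_cliques V E t" and ?w = "\<lambda>I. clique_weight t (clique_alpha V E I)"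
  define \<beta> where "\<beta> I = root (t - 1) (?w I)" for I
  define B where "B = (\<Sum>I\<in>?C. \<beta> I)"
  have fC: "finite ?C" and C: "?C \<noteq> {}"
    using finite_t_cliques[OF G] t_cliques_nonempty[OF G t(2)] by auto
  have w: "0 < ?w I" if "I \<in> ?C" for I
    using clique_weight_pos clique_alpha_bounds(1)[OF G that] by blast
  then have \<beta>: "0 < \<beta> I" "\<beta> I ^ (t - 1) = ?w I" if "I \<in> ?C" for I
    using that t by (auto simp: \<beta>_def real_root_pow_pos)
  have B: "0 < B" "clique_root_sum V E t = B"
    using \<beta> fC C by (auto simp: B_def clique_root_sum_def \<beta>_def intro: sum_pos)
  have "V \<noteq> {}"
  proof
    assume "V = {}"
    obtain I where "I \<in> ?C" using C by blast
    then show False using t_cliqueD[OF G, of I t] \<open>V = {}\<close> t by simp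
  qed
  then obtain x where x: "\<And>i. i \<in> V \<Longrightarrow> 0 \<le> x i" "(\<Sum>i\<in>V. x i ^ t) = 1"
      "clique_spectral_radius V E t / t = clique_poly V E t x"
    by (rule clique_spectral_radius_variational[OF G _ t(1)]) blast
  define y where "y i = x i ^ t" for i
  define z where "z I = (\<Prod>i\<in>I. x i) / \<beta> I" for I
  define m where "m = (\<Sum>I\<in>?C. \<beta> I * z I) / (\<Sum>I\<in>?C. \<beta> I)"
  have z: "0 \<le> z I" if "I \<in> ?C" for I
    unfolding z_def using that x(1) t_clique_vertex[OF G that] \<beta>[OF that]
    by (intro divide_nonneg_nonneg prod_nonneg) auto
  have bz: "\<beta> I * z I = (\<Prod>i\<in>I. x i)" if "I \<in> ?C" for I
    using \<beta>[OF that] by (simp add: z_def)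
  have P: "(\<Sum>I\<in>?C. \<beta> I * z I) = clique_poly V E t x"
    using bz by (simp add: set_poly_def)
  have "\<beta> I * z I ^ t = 1 / ?w I * (\<Prod>i\<in>I. y i)" if "I \<in> ?C" for I
  proof -
    have "\<beta> I ^ t = \<beta> I * ?w I"
      using \<beta>(2)[OF that] t(1) by (simp add: power_eq_if)
    then show ?thesis
      using \<beta>(1)[OF that] by (simp add: z_def y_def power_divide prod_power_distrib)
  qed
  then have L: "(\<Sum>I\<in>?C. \<beta> I * z I ^ t) = clique_lagrangian V E t y"
    by (simp add: clique_lagrangian_def set_poly_def)
  have sy: "sum y V = 1" and y0: "\<And>i. i \<in> V \<Longrightarrow> 0 \<le> y i"
    using x by (simp_all add: y_def)
  let ?gap = "real (t - 1) * m ^ (t - 2) * (\<Sum>I\<in>?C. \<beta> I * (z I - m)\<^sup>2)"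
  have gap: "clique_poly V E t x ^ t + B ^ (t - 1) * ?gap \<le> B ^ (t - 1) * clique_lagrangian V E t y"
    using power_mean_gap[OF fC C, of \<beta> z t, OF \<beta>(1) z t(1)] unfolding P L m_def B_def .
  have m0: "0 \<le> m" unfolding m_def
    using z \<beta>(1) by (intro divide_nonneg_nonneg sum_nonneg mult_nonneg_nonneg) (auto simp: less_imp_le)
  have S0: "0 \<le> (\<Sum>I\<in>?C. \<beta> I * (z I - m)\<^sup>2)"
    using \<beta>(1) by (intro sum_nonneg mult_nonneg_nonneg) (auto simp: less_imp_le)
  have g0: "0 \<le> B ^ (t - 1) * ?gap"
    using S0 m0 B by (intro mult_nonneg_nonneg) auto
  show thesis
  proof (rule that[of y m])
    show "(clique_spectral_radius V E t / t) ^ t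
        \<le> clique_root_sum V E t ^ (t - 1) * clique_lagrangian V E t y"
      unfolding x(3) B(2) using gap g0 by linarith
  next
    assume "(clique_spectral_radius V E t / t) ^ t = clique_root_sum V E t ^ (t - 1)"
    then have eq: "clique_poly V E t x ^ t = B ^ (t - 1)" unfolding x(3) B(2) .
    have "clique_poly V E t x \<noteq> 0" using eq B(1) t by (auto simp: power_0_left)
    then have "m \<noteq> 0" using B(1) by (simp add: m_def P flip: B_def)
    then have m: "0 < m" using m0 by simp
    have "clique_lagrangian V E t y \<le> 1"
      using localized_motzkin_straus[OF G t(1), of y] y0 sy by simp
    then have "B ^ (t - 1) * clique_lagrangian V E t y \<le> B ^ (t - 1)"
      using B(1) by (simp add: mult_left_le)
    then have "B ^ (t - 1) * ?gap \<le> 0" using gap eq by linarith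
    moreover have "0 < B ^ (t - 1) * (real (t - 1) * m ^ (t - 2))"
      using B(1) m t by simp
    then have "0 < B ^ (t - 1) * ?gap" if "0 < (\<Sum>I\<in>?C. \<beta> I * (z I - m)\<^sup>2)"
      using mult_pos_pos[OF _ that, of "B ^ (t - 1) * (real (t - 1) * m ^ (t - 2))"]
      by (simp only: mult.assoc)
    ultimately have "\<not> 0 < (\<Sum>I\<in>?C. \<beta> I * (z I - m)\<^sup>2)" by (meson not_le)
    then have "(\<Sum>I\<in>?C. \<beta> I * (z I - m)\<^sup>2) = 0" using S0 by linarith
    then have zero: "\<forall>I\<in>?C. \<beta> I * (z I - m)\<^sup>2 = 0"
      using \<beta>(1) fC by (subst (asm) sum_nonneg_eq_0_iff) (auto simp: less_imp_le)
    have "(\<Prod>i\<in>I. y i) = (m * \<beta> I) ^ t" if "I \<in> ?C" for I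
    proof -
      have "z I = m" using zero that \<beta>(1)[OF that] by fastforce
      then have "(\<Prod>i\<in>I. x i) = m * \<beta> I" using bz[OF that] by (simp add: mult.commute)
      then show ?thesis by (simp add: y_def flip: prod_power_distrib)
    qed
    then show "0 < m \<and> (\<forall>I\<in>?C. (\<Prod>i\<in>I. y i) = (m * root (t - 1) (?w I)) ^ t)"
      using m by (simp add: \<beta>_def)
  qed (use y0 sy in auto)
qed

text \<open>
  Weight outside all \<open>t\<close>-cliques is wasted: deleting it keeps the Lagrangian but lowers the bound
  \<open>(\<Sum> y)^t\<close>.
\<close>
lemma extremal_support:
  assumes G: "simple_graph V E" and t: "2 \<le> t" and nonneg: "\<And>i. i \<in> V \<Longrightarrow> 0 \<le> y i"
    and ext: "clique_lagrangian V E t y = sum y V ^ t"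
    and i: "i \<in> V" "i \<notin> \<Union>(t_cliques V E t)" and "0 < sum y V"
  shows "y i = 0"
proof (rule ccontr)
  assume "y i \<noteq> 0"
  then have yi: "0 < y i" using nonneg[OF i(1)] by simp
  have V: "finite V" using G by (simp add: simple_graph_def)
  let ?y = "y(i := 0)"
  have s: "sum ?y V = sum y V - y i"
  proof -
    have "sum ?y (V - {i}) = sum y (V - {i})" by (rule sum.cong) auto
    then show ?thesis using V i(1) by (simp add: sum.remove)
  qed
  have "clique_lagrangian V E t y = clique_lagrangian V E t ?y"
    unfolding clique_lagrangian_def using i(2) by (intro set_poly_cong) auto
  also have "\<dots> \<le> sum ?y V ^ t"
    using nonneg by (intro localized_motzkin_straus[OF G t]) auto
  also have "\<dots> < sum y V ^ t"
    using nonneg yi t s by (intro power_strict_mono sum_nonneg) auto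
  finally show False using ext by simp
qed

context t_clique_multipartite
begin

lemma clique_root_sum_power:
  "clique_root_sum V E t ^ (t - 1)
    = real (card (t_cliques V E t)) ^ (t - 1) * clique_weight t (clique_number V E)"
proof -
  have "clique_root_sum V E t = card (t_cliques V E t) * root (t - 1) (clique_weight t (clique_number V E))"
    unfolding clique_root_sum_def using clique_alpha_eq by simp
  then show ?thesis
    using t_ge clique_weight_pos[OF t_le] by (simp add: power_mult_distrib real_root_pow_pos)
qed

text \<open>
  Since \<open>\<alpha>\<close> is constant, a constant \<open>y\<^sup>I = q\<close> is the equality case of the power mean inequality. The
  test vector \<open>x i = root t (y i)\<close> in the variational formula therefore attains the bound.
\<close>
lemma equality_if_constant_product:
  assumes nonneg: "\<And>i. i \<in> V \<Longrightarrow> 0 \<le> y i" and "sum y V = 1"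
    and ext: "clique_lagrangian V E t y = 1"
    and const: "\<And>I. I \<in> t_cliques V E t \<Longrightarrow> (\<Prod>i\<in>I. y i) = q"
  shows "clique_root_sum V E t ^ (t - 1) \<le> (clique_spectral_radius V E t / t) ^ t"
proof -
  let ?C = "t_cliques V E t"
  define N where "N = real (card ?C)"
  have w: "0 < clique_weight t (clique_number V E)" by (rule clique_weight_pos[OF t_le])
  obtain I where I: "I \<in> ?C" using t_cliques_nonempty[OF graph t_le] by blast
  then have "V \<noteq> {}" using t_cliqueD[OF graph I] t_ge by auto
  then have var: "clique_poly V E t z \<le> clique_spectral_radius V E t / t * (\<Sum>i\<in>V. z i ^ t)"
    if "\<And>i. i \<in> V \<Longrightarrow> 0 \<le> z i" for z
    using clique_spectral_radius_variational[OF graph _ t_ge] that by metis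
  have q: "0 \<le> q" using const[OF I] nonneg t_clique_vertex[OF graph I] by (auto intro: prod_nonneg)
  have "clique_lagrangian V E t y = N * q / clique_weight t (clique_number V E)"
    unfolding clique_lagrangian_def set_poly_def N_def using const clique_alpha_eq by simp
  then have Nq: "N * q = clique_weight t (clique_number V E)" using ext w by simp
  define x where "x i = root t (y i)" for i
  have xt: "x i ^ t = y i" if "i \<in> V" for i
    using nonneg[OF that] t_ge by (simp add: x_def real_root_pow_pos2)
  have "clique_poly V E t x \<le> clique_spectral_radius V E t / t * (\<Sum>i\<in>V. x i ^ t)"
    using nonneg t_ge by (intro var) (simp add: x_def)
  then have le: "clique_poly V E t x \<le> clique_spectral_radius V E t / t"
    using xt assms(2) by simp
  have "(\<Prod>i\<in>I. x i) = root t q" if "I \<in> ?C" for I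
  proof -
    have "0 \<le> (\<Prod>i\<in>I. x i)"
      using nonneg t_clique_vertex[OF graph that] t_ge by (intro prod_nonneg) (simp add: x_def)
    moreover have "(\<Prod>i\<in>I. x i) ^ t = q"
      using xt t_clique_vertex[OF graph that] const[OF that] by (simp add: prod_power_distrib)
    ultimately show ?thesis using t_ge by (intro real_root_pos_unique[symmetric]) auto
  qed
  then have P: "clique_poly V E t x = N * root t q"
    by (simp add: set_poly_def N_def)
  have "clique_root_sum V E t ^ (t - 1) = N ^ (t - 1) * (N * q)"
    by (simp only: clique_root_sum_power Nq N_def[symmetric])
  also have "\<dots> = N ^ t * q"
    using t_ge by (simp add: power_eq_if)
  also have "\<dots> = (N * root t q) ^ t"
    using q t_ge by (simp add: power_mult_distrib real_root_pow_pos2)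
  also have "\<dots> \<le> (clique_spectral_radius V E t / t) ^ t"
    using le q t_ge unfolding P by (intro power_mono) (auto simp: N_def)
  finally show ?thesis .
qed

text \<open>
  Every block carries the total weight \<open>1 / card P\<close>, spread evenly. The sum has a single term, given
  by the block of \<open>i\<close>, and is empty for a vertex outside all blocks.
\<close>
definition balanced_weight :: "'a \<Rightarrow> real" where
  "balanced_weight i = (\<Sum>A | A \<in> P \<and> i \<in> A. 1 / (real (card P) * real (card A)))"

lemma balanced_weight_block:
  assumes "A \<in> P" "i \<in> A"
  shows "balanced_weight i = 1 / (real (card P) * real (card A))"
proof -
  have "B = A" if "B \<in> P" "i \<in> B" for B
    using disjointD[OF disjoint_P, of A B] assms that by blast
  then have "{A. A \<in> P \<and> i \<in> A} = {A}" using assms by blast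
  then show ?thesis by (simp add: balanced_weight_def)
qed

lemma sum_balanced_block:
  assumes "A \<in> P"
  shows "sum balanced_weight A = 1 / real (card P)"
proof -
  have "sum balanced_weight A = (\<Sum>i\<in>A. 1 / (real (card P) * real (card A)))"
    using balanced_weight_block[OF assms] by (rule sum.cong[OF refl])
  moreover have "card A \<noteq> 0"
    using finite_block[OF assms] nonempty_P assms by auto
  ultimately show ?thesis by simp
qed

lemma sum_blocks: "sum y W = (\<Sum>A\<in>P. sum y A)"
  unfolding Union_P[symmetric] using finite_block disjointD[OF disjoint_P]
  by (subst sum.Union_disjoint) auto

lemma sum_W: "(\<And>i. i \<in> V - W \<Longrightarrow> y i = 0) \<Longrightarrow> sum y V = (sum y W :: real)"
  using graph sub by (intro sum.mono_neutral_right) (auto simp: simple_graph_def)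

text \<open>
  The balanced weight has constant products over the transversals for two different reasons: when
  \<open>card P = t\<close>, every transversal meets every block once, and when the blocks have the same size, the
  weight itself is constant.
\<close>
lemma equality_if_balanced:
  assumes "card P = t \<or> (\<forall>A\<in>P. \<forall>B\<in>P. card A = card B)"
  shows "clique_root_sum V E t ^ (t - 1) \<le> (clique_spectral_radius V E t / t) ^ t"
proof -
  let ?y = balanced_weight
  have P: "card P \<noteq> 0" using card_blocks t_le t_ge by simp
  have "\<exists>q. \<forall>I\<in>transversals P t. (\<Prod>i\<in>I. ?y i) = q"
    using assms
  proof
    assume cP: "card P = t"
    have "(\<Prod>i\<in>I. ?y i) = (\<Prod>A\<in>P. 1 / (real (card P) * real (card A)))"
      if I: "I \<in> transversals P t" for I
    proof -
      have "\<forall>i\<in>I. \<exists>A. A \<in> P \<and> i \<in> A" using transversalsD(1)[OF I] by blast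
      then obtain b where b: "\<forall>i\<in>I. b i \<in> P \<and> i \<in> b i" unfolding bchoice_iff by blast
      have inj: "inj_on b I"
        by (rule inj_onI) (metis transversalsD(4)[OF I] b)
      have "card (b ` I) = card P"
        using card_image[OF inj] transversalsD(3)[OF I] cP by simp
      moreover have "b ` I \<subseteq> P" using b by blast
      ultimately have bI: "b ` I = P" by (intro card_subset_eq[OF finite_P])
      have "(\<Prod>A\<in>b ` I. 1 / (real (card P) * real (card A)))
          = (\<Prod>i\<in>I. 1 / (real (card P) * real (card (b i))))"
        by (simp add: prod.reindex[OF inj])
      also have "\<dots> = (\<Prod>i\<in>I. ?y i)"
        using b balanced_weight_block by (intro prod.cong) auto
      finally show ?thesis unfolding bI by simp
    qed
    then show ?thesis by blast
  next
    assume reg: "\<forall>A\<in>P. \<forall>B\<in>P. card A = card B"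
    obtain A0 where A0: "A0 \<in> P" using P by fastforce
    have "(\<Prod>i\<in>I. ?y i) = (1 / (real (card P) * real (card A0))) ^ t"
      if I: "I \<in> transversals P t" for I
    proof -
      have "(\<Prod>i\<in>I. ?y i) = (\<Prod>i\<in>I. 1 / (real (card P) * real (card A0)))"
      proof (rule prod.cong[OF refl])
        fix i assume "i \<in> I"
        then obtain A where "A \<in> P" "i \<in> A" using transversalsD(1)[OF I] by blast
        moreover have "card A = card A0" using reg A0 \<open>A \<in> P\<close> by blast
        ultimately show "?y i = 1 / (real (card P) * real (card A0))"
          using balanced_weight_block by simp
      qed
      then show ?thesis using transversalsD(3)[OF I] by simp
    qed
    then show ?thesis by blast
  qed
  then obtain q where q: "\<And>I. I \<in> t_cliques V E t \<Longrightarrow> (\<Prod>i\<in>I. ?y i) = q"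
    using t_cliques_eq_transversals[OF order_refl] by auto
  have "?y i = 0" if "i \<in> V - W" for i
    using that Union_P by (auto simp: balanced_weight_def intro: sum.neutral)
  then have "sum ?y V = (\<Sum>A\<in>P. sum ?y A)"
    using sum_W sum_blocks by simp
  then have s: "sum ?y V = 1" using P sum_balanced_block by simp
  have "esym P t (\<lambda>A. sum ?y A) = clique_weight t (card P)"
    using esym_const[OF finite_P, of "\<lambda>A. sum ?y A" "1 / real (card P)" t] sum_balanced_block
    by (simp add: clique_weight_def power_divide)
  then have "clique_lagrangian V E t ?y = 1"
    using clique_weight_pos[OF t_le] by (simp add: clique_lagrangian_eq_esym card_blocks)
  then show ?thesis
    using q s by (intro equality_if_constant_product[of ?y q]) (auto simp: balanced_weight_def sum_nonneg)
qed

text \<open>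
  With more than \<open>t\<close> blocks there are \<open>t - 1\<close> blocks besides those of \<open>u\<close> and \<open>v\<close>. A transversal of
  these extends by \<open>u\<close> and by \<open>v\<close> to a \<open>t\<close>-clique, and comparing the two products gives the claim.
\<close>
lemma constant_product_imp_constant:
  assumes "t + 1 \<le> clique_number V E" "\<And>i. i \<in> W \<Longrightarrow> 0 < y i"
    and const: "\<And>I. I \<in> t_cliques V E t \<Longrightarrow> (\<Prod>i\<in>I. y i) = (q :: real)"
    and uv: "u \<in> W" "v \<in> W"
  shows "y u = y v"
proof -
  obtain A B where AB: "A \<in> P" "u \<in> A" "B \<in> P" "v \<in> B" using uv Union_P by blast
  have "card P - card {A, B} \<le> card (P - {A, B})"
    by (rule diff_card_le_card_Diff) simp
  moreover have "card {A, B} \<le> 2" by (simp add: card_insert_if)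
  ultimately have "t - 1 \<le> card (P - {A, B})"
    using assms(1) card_blocks by linarith
  then obtain Q where Q: "Q \<subseteq> P - {A, B}" "card Q = t - 1" "finite Q"
    using obtain_subset_with_card_n by metis
  then have "disjoint Q" "{} \<notin> Q"
    using disjoint_P nonempty_P by (auto intro: pairwise_subset)
  moreover have "{} \<in> transversals Q 0" by (simp add: transversals_def)
  ultimately obtain K where K: "K \<in> transversals Q (t - 1)"
    using transversal_extend[OF Q(3)] Q(2) by metis
  have KW: "K \<subseteq> W" using transversalsD(1)[OF K] Q(1) Union_P by blast
  have ext: "y a * (\<Prod>i\<in>K. y i) = q" if "D \<in> {A, B}" "a \<in> D" for a D
  proof -
    have "D \<in> P - Q" "Q \<subseteq> P" using AB Q(1) that(1) by auto
    then have "insert a K \<in> transversals P (Suc (t - 1))" "a \<notin> K"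
      using transversals_insert[OF K _ _ disjoint_P that(2)] by blast+
    moreover have "Suc (t - 1) = t" using t_ge by simp
    ultimately have "(\<Prod>i\<in>insert a K. y i) = q"
      using const t_cliques_eq_transversals[OF order_refl] by simp
    then show ?thesis using \<open>a \<notin> K\<close> transversalsD(2)[OF K] by simp
  qed
  have "y u * (\<Prod>i\<in>K. y i) = y v * (\<Prod>i\<in>K. y i)"
    using ext[of A u] ext[of B v] AB by simp
  moreover have "0 < (\<Prod>i\<in>K. y i)" using assms(2) KW by (intro prod_pos) auto
  ultimately show ?thesis by simp
qed

text \<open>
  As \<open>y\<close> is constant, blocks of different sizes would have different total weights, and Maclaurin's
  inequality for the block weights would be strict.
\<close>
lemma regular_if_extremal:
  assumes "t + 1 \<le> clique_number V E" "\<And>i. i \<in> W \<Longrightarrow> 0 < y i" "\<And>i. i \<in> V - W \<Longrightarrow> y i = 0"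
    and "sum y V = 1" "clique_lagrangian V E t y = 1"
    and "\<And>I. I \<in> t_cliques V E t \<Longrightarrow> (\<Prod>i\<in>I. y i) = q"
    and AB: "A \<in> P" "B \<in> P"
  shows "card A = card B"
proof (rule ccontr)
  assume ne: "card A \<noteq> card B"
  have "A \<noteq> {}" using AB(1) nonempty_P by metis
  then obtain u where "u \<in> A" by blast
  then have u: "u \<in> W" using UnionI[OF AB(1)] Union_P by simp
  have block: "sum y D = real (card D) * y u" if "D \<in> P" for D
  proof -
    have "y i = y u" if "i \<in> D" for i
      using constant_product_imp_constant[OF assms(1,2,6) _ u, of i] UnionI[OF \<open>D \<in> P\<close> that] Union_P
      by simp
    then show ?thesis by simp
  qed
  have "sum y A \<noteq> sum y B" using ne AB block assms(2)[OF u] by simp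
  moreover have "0 < sum y D" if "D \<in> P" for D
  proof -
    have "0 < card D"
      using finite_block[OF that] nonempty_P that by (auto simp: card_gt_0_iff)
    then show ?thesis using block[OF that] assms(2)[OF u] by simp
  qed
  ultimately have "esym P t (\<lambda>A. sum y A) < real (card P choose t) * ((\<Sum>A\<in>P. sum y A) / card P) ^ t"
    using t_ge t_le card_blocks AB by (intro maclaurin_strict[OF finite_P]) auto
  also have "(\<Sum>A\<in>P. sum y A) = 1"
    unfolding sum_blocks[symmetric] using sum_W[of y] assms(3,4) by simp
  also have "real (card P choose t) * (1 / card P) ^ t = clique_weight t (clique_number V E)"
    by (simp add: clique_weight_def card_blocks power_divide)
  finally show False
    using assms(5) clique_weight_pos[OF t_le] by (simp add: clique_lagrangian_eq_esym)
qed

end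

lemma spectral_bound:
  assumes "simple_graph V E" "2 \<le> t" "t \<le> clique_number V E"
  shows "(clique_spectral_radius V E t / t) ^ t \<le> clique_root_sum V E t ^ (t - 1)"
proof -
  obtain y where y: "\<And>i. i \<in> V \<Longrightarrow> 0 \<le> y i" "sum y V = 1"
    "(clique_spectral_radius V E t / t) ^ t \<le> clique_root_sum V E t ^ (t - 1) * clique_lagrangian V E t y"
    using spectral_radius_le_lagrangian[OF assms] by metis
  have "clique_lagrangian V E t y \<le> 1"
    using localized_motzkin_straus[OF assms(1,2), of y] y by simp
  moreover have "0 \<le> clique_root_sum V E t"
    unfolding clique_root_sum_def clique_weight_def using assms(2) by (intro sum_nonneg) simp
  ultimately have "clique_root_sum V E t ^ (t - 1) * clique_lagrangian V E t y \<le> clique_root_sum V E t ^ (t - 1)"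
    by (simp add: mult_left_le)
  then show ?thesis using y(3) by linarith
qed

text \<open>
  The extremal vector of the power mean step is a maximizer of the Lagrangian that is positive exactly
  on the vertices in \<open>t\<close>-cliques, because the constant \<open>m\<close> and the roots \<open>\<beta>(I)\<close> are positive.
\<close>
lemma spectral_equality_imp_multipartite:
  assumes G: "simple_graph V E" and t: "2 \<le> t" "t \<le> clique_number V E"
    and eq: "(clique_spectral_radius V E t / t) ^ t = clique_root_sum V E t ^ (t - 1)"
  obtains W P where "t_clique_multipartite V E t W P"
    "t + 1 \<le> clique_number V E \<Longrightarrow> \<forall>A\<in>P. \<forall>B\<in>P. card A = card B"
proof -
  let ?C = "t_cliques V E t" and ?W = "\<Union>(t_cliques V E t)"
  obtain y m where y: "\<And>i. i \<in> V \<Longrightarrow> 0 \<le> y i" "sum y V = 1"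
    "(clique_spectral_radius V E t / t) ^ t \<le> clique_root_sum V E t ^ (t - 1) * clique_lagrangian V E t y"
    and m: "0 < m"
    and prod: "\<forall>I\<in>?C. (\<Prod>i\<in>I. y i) = (m * root (t - 1) (clique_weight t (clique_alpha V E I))) ^ t"
    using spectral_radius_le_lagrangian[OF G t] eq by metis
  have root_pos: "0 < root (t - 1) (clique_weight t (clique_alpha V E I))" if "I \<in> ?C" for I
    using clique_weight_pos[OF clique_alpha_bounds(1)[OF G that]] t by simp
  then have "0 < clique_root_sum V E t"
    unfolding clique_root_sum_def using finite_t_cliques[OF G] t_cliques_nonempty[OF G t(2)]
    by (intro sum_pos) auto
  then have "1 \<le> clique_lagrangian V E t y" using y(3) unfolding eq by simp
  moreover have "clique_lagrangian V E t y \<le> 1"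
    using localized_motzkin_straus[OF G t(1), of y] y by simp
  ultimately have L: "clique_lagrangian V E t y = 1" by simp
  then have ext: "clique_lagrangian V E t y = sum y V ^ t" using y(2) by simp
  have pos: "0 < y i" if I: "I \<in> ?C" "i \<in> I" for I i
  proof -
    have "(\<Prod>i\<in>I. y i) \<noteq> 0" using prod root_pos[OF I(1)] m I(1) by simp
    then have "y i \<noteq> 0" using I t_cliqueD(4)[OF G I(1)] by auto
    then show ?thesis using y(1)[OF t_clique_vertex[OF G I]] by simp
  qed
  obtain P where P: "t_clique_multipartite V E t ?W P"
    by (rule extremal_multipartite[OF G t, of y]) (use y(1) ext pos in blast)+
  interpret t_clique_multipartite V E t ?W P by (rule P)
  have "card A = card B" if h: "t + 1 \<le> clique_number V E" "A \<in> P" "B \<in> P" for A B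
  proof (rule regular_if_extremal[OF h(1) _ _ y(2) L _ h(2,3)])
    show "0 < y i" if "i \<in> ?W" for i using that pos by blast
    show "y i = 0" if "i \<in> V - ?W" for i
      using extremal_support[OF G t(1) y(1) ext, of i] that y(2) by simp
    show "(\<Prod>i\<in>I. y i) = (m * root (t - 1) (clique_weight t (clique_number V E))) ^ t"
      if "I \<in> ?C" for I using prod clique_alpha_eq that by simp
  qed
  then show thesis using that[OF P] by blast
qed

lemma t_clique_multipartiteI:
  assumes "simple_graph V E" "2 \<le> t" "t \<le> clique_number V E"
    and "V = W \<union> S" "partition_on W P" "edges_in_t_cliques V E t = partite_edges P"
  shows "t_clique_multipartite V E t W P"
  using assms by unfold_locales auto

lemma up_to_isolatedE:
  assumes "up_to_isolated Q V E"
  obtains W S where "V = W \<union> S" "Q W E"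
  using assms unfolding up_to_isolated_def by (elim exE conjE)

theorem theorem3p1:
  fixes V :: "'a set" and E :: "'a set set" and t \<omega> :: nat
  assumes "simple_graph V E"
    and "\<omega> = clique_number V E"
    and "2 \<le> t" and "t \<le> \<omega>"
  shows "(clique_spectral_radius V E t / real t) ^ t
           \<le> (\<Sum>I\<in>t_cliques V E t.
                root (t - 1) (real (clique_alpha V E I choose t) / real (clique_alpha V E I) ^ t))
             ^ (t - 1)
         \<and>
         ((clique_spectral_radius V E t / real t) ^ t
           = (\<Sum>I\<in>t_cliques V E t.
                root (t - 1) (real (clique_alpha V E I choose t) / real (clique_alpha V E I) ^ t))
             ^ (t - 1)
         \<longleftrightarrow>
           (\<omega> = t \<and> up_to_isolated (complete_partite \<omega>) V (edges_in_t_cliques V E t)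
            \<or> \<omega> \<ge> t + 1 \<and>
               up_to_isolated (complete_regular_partite \<omega>) V (edges_in_t_cliques V E t)))"
    (is "?lhs \<le> ?rhs \<and> (?lhs = ?rhs \<longleftrightarrow> ?multipartite)")
proof -
  have t: "t \<le> clique_number V E" using assms by simp
  have rhs: "?rhs = clique_root_sum V E t ^ (t - 1)"
    by (simp add: clique_root_sum_def clique_weight_def)
  have le: "?lhs \<le> ?rhs" unfolding rhs by (rule spectral_bound[OF assms(1,3) t])
  moreover have ?multipartite if eq: "?lhs = ?rhs"
  proof -
    obtain W P where M: "t_clique_multipartite V E t W P"
      and reg: "t + 1 \<le> clique_number V E \<Longrightarrow> \<forall>A\<in>P. \<forall>B\<in>P. card A = card B"
      using spectral_equality_imp_multipartite[OF assms(1,3) t] eq unfolding rhs by blast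
    interpret t_clique_multipartite V E t W P by (rule M)
    have split: "V = W \<union> (V - W)" "W \<inter> (V - W) = {}" using sub by auto
    have card: "card P = \<omega>" using card_blocks assms(2) by simp
    show ?multipartite
    proof (cases "\<omega> = t")
      case True
      have "complete_partite \<omega> W (edges_in_t_cliques V E t)"
        unfolding complete_partite_def using part card edges by blast
      then show ?thesis using True split unfolding up_to_isolated_def by blast
    next
      case False
      then have ge: "t + 1 \<le> \<omega>" using assms(4) by simp
      have "\<forall>A\<in>P. \<forall>B\<in>P. card A = card B" using reg[OF ge[unfolded assms(2)]] .
      then have "complete_regular_partite \<omega> W (edges_in_t_cliques V E t)"
        unfolding complete_regular_partite_def using part card edges by blast
      then show ?thesis using ge split unfolding up_to_isolated_def by blast
    qed
  qed
  moreover have "?lhs = ?rhs" if h: ?multipartite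
  proof -
    obtain W S P where P: "V = W \<union> S" "partition_on W P" "edges_in_t_cliques V E t = partite_edges P"
      "card P = t \<or> (\<forall>A\<in>P. \<forall>B\<in>P. card A = card B)"
      using h
    proof (elim disjE conjE)
      assume "\<omega> = t" "up_to_isolated (complete_partite \<omega>) V (edges_in_t_cliques V E t)"
      then obtain W S where "V = W \<union> S" "complete_partite t W (edges_in_t_cliques V E t)"
        by (auto elim: up_to_isolatedE)
      moreover from this(2) obtain P where "partition_on W P" "card P = t"
        "edges_in_t_cliques V E t = partite_edges P"
        unfolding complete_partite_def by (elim exE conjE)
      ultimately show ?thesis using that by simp
    next
      assume "up_to_isolated (complete_regular_partite \<omega>) V (edges_in_t_cliques V E t)"
      then obtain W S where W: "V = W \<union> S" "complete_regular_partite \<omega> W (edges_in_t_cliques V E t)"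
        by (rule up_to_isolatedE)
      from W(2) obtain P where P: "partition_on W P"
        "edges_in_t_cliques V E t = partite_edges P" "\<forall>A\<in>P. \<forall>B\<in>P. card A = card B"
        unfolding complete_regular_partite_def by (elim exE conjE)
      show ?thesis by (rule that[OF W(1) P(1,2) disjI2[OF P(3)]])
    qed
    interpret t_clique_multipartite V E t W P
      by (rule t_clique_multipartiteI[OF assms(1,3) t P(1,2,3)])
    have "?rhs \<le> ?lhs" unfolding rhs by (rule equality_if_balanced[OF P(4)])
    then show ?thesis using le by simp
  qed
  ultimately show ?thesis by blast
qed

end
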